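(* For every odd prime $p$, there exists a group $G$ of order $p^8$ such that $\mathrm{Aut}(G)$ is elementary abelian of order $p^{16}$, $\gamma_2(G) < \Phi(G)$, and $Z(G) = \Phi(G)$ is elementary abelian.
   Context: For a finite group $G$, $\gamma_2(G)$, $Z(G)$ and $\Phi(G)$ denote the commutator subgroup, the center and the Frattini subgroup of $G$, respectively, and $\mathrm{Aut}(G)$ denotes the group of all automorphisms of $G$. The notation $H < K$ means that $H$ is a proper subgroup of $K$. *)

theory Defs
  imports "HOL-Algebra.Algebra"
begin

definition center :: "('a, 'b) monoid_scheme \<Rightarrow> 'a set" where
  "center G = {z \<in> carrier G. \<forall>x \<in> carrier G. z \<otimes>\<^bsub>G\<^esub> x = x \<otimes>\<^bsub>G\<^esub> z}"

definition maximal_subgroup :: "'a set \<Rightarrow> ('a, 'b) monoid_scheme \<Rightarrow> bool" where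
  "maximal_subgroup M G \<longleftrightarrow>
     subgroup M G \<and> M \<noteq> carrier G \<and>
     (\<forall>H. subgroup H G \<longrightarrow> M \<subseteq> H \<longrightarrow> H = M \<or> H = carrier G)"

text \<open>Intersecting with the carrier makes the Frattini subgroup the whole group
  when there are no maximal subgroups.\<close>

definition frattini :: "('a, 'b) monoid_scheme \<Rightarrow> 'a set" where
  "frattini G = carrier G \<inter> \<Inter>{M. maximal_subgroup M G}"

definition elementary_abelian :: "nat \<Rightarrow> ('a, 'b) monoid_scheme \<Rightarrow> bool" where
  "elementary_abelian p G \<longleftrightarrow>
     Factorial_Ring.prime p \<and> comm_group G \<and> (\<forall>x \<in> carrier G. x [^]\<^bsub>G\<^esub> p = \<one>\<^bsub>G\<^esub>)"

context group
begin

lemma subgroup_frattini: "subgroup (frattini G) G"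
  unfolding frattini_def maximal_subgroup_def
  by (intro subgroupI) (auto intro: subgroup.m_closed subgroup.m_inv_closed subgroup.one_closed)

lemma subgroup_center: "subgroup (center G) G"
proof (intro subgroupI)
  fix a assume a: "a \<in> center G"
  show "inv a \<in> center G"
    unfolding center_def
  proof (intro CollectI conjI ballI)
    show "inv a \<in> carrier G" using a by (simp add: center_def)
    fix x assume x: "x \<in> carrier G"
    have ac: "a \<in> carrier G" and com: "a \<otimes> inv x = inv x \<otimes> a"
      using a x by (auto simp: center_def)
    have "inv (a \<otimes> inv x) = inv (inv x \<otimes> a)" using com by simp
    then show "inv a \<otimes> x = x \<otimes> inv a"
      using ac x by (simp add: inv_mult_group)
  qed
next
  fix a b assume ab: "a \<in> center G" "b \<in> center G"
  then have ac: "a \<in> carrier G" "b \<in> carrier G" by (auto simp: center_def)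
  have "a \<otimes> b \<otimes> x = x \<otimes> (a \<otimes> b)" if x: "x \<in> carrier G" for x
  proof -
    have "a \<otimes> b \<otimes> x = a \<otimes> (b \<otimes> x)" using ac x by (simp add: m_assoc)
    also have "\<dots> = a \<otimes> (x \<otimes> b)" using ab x by (simp add: center_def)
    also have "\<dots> = a \<otimes> x \<otimes> b" using ac x by (simp add: m_assoc)
    also have "\<dots> = x \<otimes> a \<otimes> b" using ab x by (simp add: center_def)
    finally show ?thesis using ac x by (simp add: m_assoc)
  qed
  then show "a \<otimes> b \<in> center G" using ac by (simp add: center_def)
qed (auto simp: center_def)

end

end

theory Submission
  imports Defs "HOL-Number_Theory.Cong" "HOL-Library.Countable"
begin

text \<open>
  On \<open>(\<int>/p\<^sup>2)\<^sup>n\<close> the product \<open>x + y + p \<beta>(x, y)\<close>, with \<open>\<beta>\<close> bilinear modulo \<open>p\<close>, defines a group \<open>G\<close>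
  in which, \<open>p\<close> being odd, the \<open>p\<close>-th power of \<open>x\<close> is \<open>p x\<close> and the commutator of \<open>x\<close> and \<open>y\<close> is
  \<open>p [x, y]\<close>, where \<open>[x, y] = \<beta>(x, y) - \<beta>(y, x)\<close>. The Frattini subgroup is \<open>p G\<close>, and the power map
  identifies it with the quotient \<open>V = G / p G\<close>, so every automorphism of \<open>G\<close> induces an automorphism
  of the anticommutative algebra \<open>(V, [,])\<close> over the field with \<open>p\<close> elements. If that algebra has only
  the trivial automorphism, then the automorphisms of \<open>G\<close> are the maps \<open>x \<mapsto> x \<zeta>(x)\<close> with
  \<open>\<zeta> \<in> Hom(V, p G)\<close>, an elementary abelian group of order \<open>p\<close> to the \<open>n\<^sup>2\<close>. It remains to find such an
  algebra of dimension 4 with zero annihilator and not spanned by brackets.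
\<close>

section \<open>Central extensions carried by \<open>(\<int>/p\<^sup>2)\<^sup>n\<close>\<close>

locale twisted_group =
  fixes p n :: nat and b :: "nat \<Rightarrow> nat \<Rightarrow> nat \<Rightarrow> int"
  assumes prime_p: "Factorial_Ring.prime p" and odd_p: "odd p"
begin

text \<open>Only the entries \<open>b i j k\<close> with \<open>k < j\<close> enter, so that ordered products of powers of the
  standard generators acquire no correction term.\<close>

definition \<beta> :: "nat \<Rightarrow> (nat \<Rightarrow> int) \<Rightarrow> (nat \<Rightarrow> int) \<Rightarrow> int" where
  "\<beta> i x y = (\<Sum>j<n. \<Sum>k<j. b i j k * x j * y k)"

text \<open>Coordinates are reduced modulo \<open>p^2\<close> and the list is coded as a number, so
  that the group lives on type \<open>nat\<close> and equal codes mean congruent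
  coordinates.\<close>

definition vec :: "(nat \<Rightarrow> int) \<Rightarrow> nat" where
  "vec f = to_nat (map (\<lambda>i. f i mod (int p)\<^sup>2) [0..<n])"

text \<open>Decoding is meaningful only for indices below \<open>n\<close>, since \<open>!\<close>
  is unspecified past the end of a list; this is why coordinate statements carry
  \<open>i < n\<close>.\<close>

definition crd :: "nat \<Rightarrow> nat \<Rightarrow> int" where
  "crd x i = (from_nat x :: int list) ! i"

definition G :: "nat monoid" where
  "G = \<lparr>carrier = range vec,
        monoid.mult = \<lambda>x y. vec (\<lambda>i. crd x i + crd y i + int p * \<beta> i (crd x) (crd y)),
        monoid.one = vec (\<lambda>_. 0)\<rparr>"

definition e :: "nat \<Rightarrow> nat" where
  "e j = vec (\<lambda>i. if i = j then 1 else 0)"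

text \<open>This is the \<open>p G\<close> of the outline. It turns out to be the set of
  \<open>p\<close>-th powers, the Frattini subgroup and, for the concrete algebra, the
  center.\<close>

definition pV :: "nat set" where
  "pV = {x \<in> carrier G. \<forall>i<n. [crd x i = 0] (mod int p)}"

section \<open>Bilinearity and the two moduli\<close>

lemma beta_add_left: "\<beta> i (\<lambda>j. x j + x' j) y = \<beta> i x y + \<beta> i x' y"
  by (simp add: \<beta>_def sum.distrib algebra_simps)

lemma beta_add_right: "\<beta> i x (\<lambda>j. y j + y' j) = \<beta> i x y + \<beta> i x y'"
  by (simp add: \<beta>_def sum.distrib algebra_simps)

lemma beta_scale_left: "\<beta> i (\<lambda>j. a * x j) y = a * \<beta> i x y"
  by (simp add: \<beta>_def sum_distrib_left algebra_simps)

lemma beta_cong: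
  assumes "\<And>j. j < n \<Longrightarrow> [x j = x' j] (mod m)" "\<And>j. j < n \<Longrightarrow> [y j = y' j] (mod m)"
  shows "[\<beta> i x y = \<beta> i x' y'] (mod m)"
  unfolding \<beta>_def using assms by (intro cong_sum cong_mult) auto

lemma p_gt_0: "p > 0"
  using prime_p prime_gt_0_nat by blast

text \<open>Because of the factor \<open>p\<close>, the correction term modulo \<open>p^2\<close>
  depends on the arguments of \<beta> only modulo \<open>p\<close>.\<close>

lemma cong_p_mult: "[u = v] (mod int p) \<Longrightarrow> [int p * u = int p * v] (mod (int p)\<^sup>2)"
  by (auto simp: cong_iff_dvd_diff power2_eq_square simp flip: right_diff_distrib)

lemma cong_p_mult_iff: "[int p * u = int p * v] (mod (int p)\<^sup>2) \<longleftrightarrow> [u = v] (mod int p)"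
  using p_gt_0 by (auto simp: cong_iff_dvd_diff power2_eq_square simp flip: right_diff_distrib)

lemma cong_p2_imp_p: "[u = v] (mod (int p)\<^sup>2) \<Longrightarrow> [u = v] (mod int p)"
  by (rule cong_dvd_mono_modulus) auto

lemma crd_vec: "i < n \<Longrightarrow> [crd (vec f) i = f i] (mod (int p)\<^sup>2)"
  by (simp add: crd_def vec_def)

lemma crd_vec_p: "i < n \<Longrightarrow> [crd (vec f) i = f i] (mod int p)"
  by (intro cong_p2_imp_p crd_vec)

lemma vec_eq: "(\<And>i. i < n \<Longrightarrow> [f i = g i] (mod (int p)\<^sup>2)) \<Longrightarrow> vec f = vec g"
  by (simp add: vec_def cong_def)

lemma vec_in_carrier [simp, intro]: "vec f \<in> carrier G"
  by (simp add: G_def)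

lemma vec_crd: "x \<in> carrier G \<Longrightarrow> vec (crd x) = x"
  by (auto simp: G_def intro!: vec_eq crd_vec)

lemma crd_eqI:
  assumes "x \<in> carrier G" "y \<in> carrier G" "\<And>i. i < n \<Longrightarrow> [crd x i = crd y i] (mod (int p)\<^sup>2)"
  shows "x = y"
  using vec_eq[of "crd x" "crd y"] assms by (simp add: vec_crd)

lemma crd_mult: "i < n \<Longrightarrow>
  [crd (x \<otimes>\<^bsub>G\<^esub> y) i = crd x i + crd y i + int p * \<beta> i (crd x) (crd y)] (mod (int p)\<^sup>2)"
  unfolding G_def monoid.simps by (rule crd_vec)

lemma crd_mult_p: "i < n \<Longrightarrow> [crd (x \<otimes>\<^bsub>G\<^esub> y) i = crd x i + crd y i] (mod int p)"
  using cong_p2_imp_p[OF crd_mult, of i x y] by (simp add: cong_def)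

lemma crd_one: "i < n \<Longrightarrow> [crd \<one>\<^bsub>G\<^esub> i = 0] (mod (int p)\<^sup>2)"
  using crd_vec[of i "\<lambda>_. 0"] by (simp add: G_def)

lemma crd_one_p: "i < n \<Longrightarrow> [crd \<one>\<^bsub>G\<^esub> i = 0] (mod int p)"
  by (intro cong_p2_imp_p crd_one)

lemma crd_e: "i < n \<Longrightarrow> [crd (e j) i = (if i = j then 1 else 0)] (mod (int p)\<^sup>2)"
  using crd_vec[of i "\<lambda>i. if i = j then 1 else 0"] by (simp add: e_def)

lemma crd_e_p: "i < n \<Longrightarrow> [crd (e j) i = (if i = j then 1 else 0)] (mod int p)"
  by (intro cong_p2_imp_p crd_e)

lemma e_closed [simp]: "e j \<in> carrier G"
  by (simp add: e_def)

section \<open>Order and group axioms\<close>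

lemma carrier_G: "carrier G = to_nat ` {xs :: int list. set xs \<subseteq> {0..<(int p)\<^sup>2} \<and> length xs = n}"
proof -
  have "vec f \<in> to_nat ` {xs :: int list. set xs \<subseteq> {0..<(int p)\<^sup>2} \<and> length xs = n}" for f
    using p_gt_0 unfolding vec_def by (intro imageI) (simp add: image_subset_iff)
  moreover have "to_nat xs \<in> range vec" if "set xs \<subseteq> {0..<(int p)\<^sup>2}" "length xs = n" for xs
  proof -
    have "xs ! i mod (int p)\<^sup>2 = xs ! i" if "i < n" for i
      using that \<open>set xs \<subseteq> _\<close> \<open>length xs = n\<close> nth_mem[of i xs]
      by (metis atLeastLessThan_iff mod_pos_pos_trivial subsetD)
    then have "map (\<lambda>i. xs ! i mod (int p)\<^sup>2) [0..<n] = xs"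
      using \<open>length xs = n\<close> by (intro nth_equalityI) auto
    then have "to_nat xs = vec (\<lambda>i. xs ! i)"
      by (simp add: vec_def)
    then show ?thesis by simp
  qed
  ultimately show ?thesis by (auto simp: G_def)
qed

lemma card_G: "card (carrier G) = p ^ (2 * n)"
proof -
  have "card (carrier G) = card {xs :: int list. set xs \<subseteq> {0..<(int p)\<^sup>2} \<and> length xs = n}"
    unfolding carrier_G by (intro card_image inj_onI) simp
  also have "\<dots> = nat ((int p)\<^sup>2) ^ n"
    by (simp add: card_lists_length_eq)
  finally show ?thesis
    by (simp add: power_mult nat_power_eq)
qed

lemma finite_G: "finite (carrier G)"
  using card_G p_gt_0 card_gt_0_iff by fastforce

text \<open>A bilinear map is a 2-cocycle: both bracketings of a triple product collect the same
  three corrections, from the pairs \<open>(x, y)\<close>, \<open>(x, z)\<close> and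
  \<open>(y, z)\<close>.\<close>

sublocale group G
proof (rule groupI)
  fix x y assume "x \<in> carrier G" "y \<in> carrier G"
  show "x \<otimes>\<^bsub>G\<^esub> y \<in> carrier G"
    by (simp add: G_def)
next
  show "\<one>\<^bsub>G\<^esub> \<in> carrier G"
    by (simp add: G_def)
next
  fix x y z assume "x \<in> carrier G" "y \<in> carrier G" "z \<in> carrier G"
  let ?X = "crd x" and ?Y = "crd y" and ?Z = "crd z"
  show "x \<otimes>\<^bsub>G\<^esub> y \<otimes>\<^bsub>G\<^esub> z = x \<otimes>\<^bsub>G\<^esub> (y \<otimes>\<^bsub>G\<^esub> z)"
  proof (rule crd_eqI)
    fix i assume i: "i < n"
    have "[crd (x \<otimes>\<^bsub>G\<^esub> y \<otimes>\<^bsub>G\<^esub> z) i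
          = (?X i + ?Y i + int p * \<beta> i ?X ?Y) + ?Z i + int p * (\<beta> i ?X ?Z + \<beta> i ?Y ?Z)] (mod (int p)\<^sup>2)"
      unfolding beta_add_left[symmetric]
      by (intro cong_trans[OF crd_mult] i cong_add crd_mult cong_refl cong_p_mult beta_cong crd_mult_p)
    moreover have "[crd (x \<otimes>\<^bsub>G\<^esub> (y \<otimes>\<^bsub>G\<^esub> z)) i
          = ?X i + (?Y i + ?Z i + int p * \<beta> i ?Y ?Z) + int p * (\<beta> i ?X ?Y + \<beta> i ?X ?Z)] (mod (int p)\<^sup>2)"
      unfolding beta_add_right[symmetric]
      by (intro cong_trans[OF crd_mult] i cong_add crd_mult cong_refl cong_p_mult beta_cong crd_mult_p)
    ultimately show "[crd (x \<otimes>\<^bsub>G\<^esub> y \<otimes>\<^bsub>G\<^esub> z) i = crd (x \<otimes>\<^bsub>G\<^esub> (y \<otimes>\<^bsub>G\<^esub> z)) i] (mod (int p)\<^sup>2)"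
      by (simp add: cong_def algebra_simps)
  qed (simp_all add: G_def)
next
  fix x assume x: "x \<in> carrier G"
  show "\<one>\<^bsub>G\<^esub> \<otimes>\<^bsub>G\<^esub> x = x"
  proof (rule crd_eqI)
    fix i assume i: "i < n"
    have "[\<beta> i (crd \<one>\<^bsub>G\<^esub>) (crd x) = \<beta> i (\<lambda>j. 0 * crd x j) (crd x)] (mod int p)"
      by (intro beta_cong) (simp_all add: crd_one_p)
    then have "[crd \<one>\<^bsub>G\<^esub> i + crd x i + int p * \<beta> i (crd \<one>\<^bsub>G\<^esub>) (crd x) = 0 + crd x i + int p * 0] (mod (int p)\<^sup>2)"
      unfolding beta_scale_left by (intro cong_add cong_refl cong_p_mult crd_one i) simp
    then show "[crd (\<one>\<^bsub>G\<^esub> \<otimes>\<^bsub>G\<^esub> x) i = crd x i] (mod (int p)\<^sup>2)"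
      using cong_trans[OF crd_mult[OF i]] by simp
  qed (use x in \<open>simp_all add: G_def\<close>)
  \<comment> \<open>Bilinearity gives \<open>\<beta>(-x, x) = -\<beta>(x, x)\<close>, which the
    additional term of the inverse cancels.\<close>
  let ?f = "\<lambda>i. -1 * crd x i + int p * \<beta> i (crd x) (crd x)"
  have "vec ?f \<otimes>\<^bsub>G\<^esub> x = \<one>\<^bsub>G\<^esub>"
  proof (rule crd_eqI)
    fix i assume i: "i < n"
    have "[crd (vec ?f) j = - 1 * crd x j] (mod int p)" if "j < n" for j
      by (rule cong_trans[OF crd_vec_p[OF that]]) (simp add: cong_iff_dvd_diff)
    then have "[\<beta> i (crd (vec ?f)) (crd x) = -1 * \<beta> i (crd x) (crd x)] (mod int p)"
      unfolding beta_scale_left[symmetric] by (intro beta_cong) auto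
    then have "[crd (vec ?f) i + crd x i + int p * \<beta> i (crd (vec ?f)) (crd x)
        = ?f i + crd x i + int p * (-1 * \<beta> i (crd x) (crd x))] (mod (int p)\<^sup>2)"
      by (intro cong_add cong_refl cong_p_mult crd_vec i)
    then have "[crd (vec ?f \<otimes>\<^bsub>G\<^esub> x) i = 0] (mod (int p)\<^sup>2)"
      using cong_trans[OF crd_mult[OF i]] by simp
    then show "[crd (vec ?f \<otimes>\<^bsub>G\<^esub> x) i = crd \<one>\<^bsub>G\<^esub> i] (mod (int p)\<^sup>2)"
      using crd_one[OF i] by (simp add: cong_def)
  qed (simp_all add: G_def)
  then show "\<exists>y\<in>carrier G. y \<otimes>\<^bsub>G\<^esub> x = \<one>\<^bsub>G\<^esub>" by blast
qed

section \<open>Powers\<close>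

lemma crd_pow_p:
  assumes "i < n"
  shows "[crd (x [^]\<^bsub>G\<^esub> k) i = int k * crd x i] (mod int p)"
proof (induction k)
  case 0
  then show ?case using crd_one_p assms by simp
next
  case (Suc k)
  have "[crd (x [^]\<^bsub>G\<^esub> k) i + crd x i = int k * crd x i + crd x i] (mod int p)"
    by (intro cong_add Suc cong_refl)
  then show ?case
    using cong_trans[OF crd_mult_p[OF assms]] by (simp add: algebra_simps)
qed

text \<open>Multiplying the \<open>k\<close>-th power by \<open>x\<close> adds
  \<open>k \<beta>(x, x)\<close> to the correction, since that power is \<open>k x\<close> modulo
  \<open>p\<close>. The sum of these multiples is the binomial coefficient.\<close>

lemma crd_pow:
  assumes "i < n"
  shows "[crd (x [^]\<^bsub>G\<^esub> k) i = int k * crd x i + int p * (int (k choose 2) * \<beta> i (crd x) (crd x))]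
    (mod (int p)\<^sup>2)"
proof (induction k)
  case 0
  then show ?case using crd_one[OF assms] by (simp add: binomial_eq_0)
next
  case (Suc k)
  let ?B = "\<beta> i (crd x) (crd x)"
  have "[\<beta> i (crd (x [^]\<^bsub>G\<^esub> k)) (crd x) = int k * ?B] (mod int p)"
    unfolding beta_scale_left[symmetric] by (intro beta_cong crd_pow_p cong_refl)
  then have "[crd (x [^]\<^bsub>G\<^esub> k) i + crd x i + int p * \<beta> i (crd (x [^]\<^bsub>G\<^esub> k)) (crd x) =
    (int k * crd x i + int p * (int (k choose 2) * ?B)) + crd x i + int p * (int k * ?B)] (mod (int p)\<^sup>2)"
    by (intro cong_add Suc cong_refl cong_p_mult)
  moreover have "(Suc k choose 2) = k + (k choose 2)"
    by (simp add: numeral_2_eq_2)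
  ultimately show ?case
    using cong_trans[OF crd_mult[OF assms]] by (simp add: algebra_simps)
qed

text \<open>An odd prime \<open>p\<close> divides \<open>p choose 2\<close>, so the correction
  disappears modulo \<open>p^2\<close>.\<close>

lemma crd_pow_prime:
  assumes "i < n"
  shows "[crd (x [^]\<^bsub>G\<^esub> p) i = int p * crd x i] (mod (int p)\<^sup>2)"
proof -
  have "p \<noteq> 2" using odd_p by auto
  then have "p dvd (p choose 2)"
    using prime_p prime_ge_2_nat[OF prime_p] by (intro dvd_choose_prime) auto
  then have "[int (p choose 2) * \<beta> i (crd x) (crd x) = 0] (mod int p)"
    by (simp add: cong_0_iff)
  from cong_p_mult[OF this] have "[int p * crd x i + int p * (int (p choose 2) * \<beta> i (crd x) (crd x))
     = int p * crd x i + int p * 0] (mod (int p)\<^sup>2)"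
    by (intro cong_add cong_refl)
  then show ?thesis
    using cong_trans[OF crd_pow[OF assms]] by simp
qed

section \<open>Inverses and commutators\<close>

text \<open>The modulus \<open>m\<close> is left open because a coordinate is always additive modulo
  \<open>p\<close>, and even modulo \<open>p^2\<close> where the component \<open>\<beta> i\<close>
  vanishes.\<close>

lemma crd_inv:
  assumes add: "\<And>x y. [crd (x \<otimes>\<^bsub>G\<^esub> y) i = crd x i + crd y i] (mod m)"
    and m: "m dvd (int p)\<^sup>2" and i: "i < n" and x: "x \<in> carrier G"
  shows "[crd (inv\<^bsub>G\<^esub> x) i = - crd x i] (mod m)"
proof -
  have "[crd \<one>\<^bsub>G\<^esub> i = 0] (mod m)"
    using crd_one[OF i] m by (rule cong_dvd_mono_modulus)
  then have "[crd (inv\<^bsub>G\<^esub> x) i + crd x i = 0] (mod m)"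
    using add[of "inv\<^bsub>G\<^esub> x" x] x by (simp add: cong_def)
  then show ?thesis
    by (simp add: cong_iff_dvd_diff)
qed

lemma crd_inv_p: "i < n \<Longrightarrow> x \<in> carrier G \<Longrightarrow> [crd (inv\<^bsub>G\<^esub> x) i = - crd x i] (mod int p)"
  by (rule crd_inv[OF crd_mult_p]) auto

text \<open>A coordinate that is additive modulo \<open>m\<close> is a homomorphism to an abelian
  group, so its kernel contains all commutators.\<close>

lemma derived_crd:
  assumes add: "\<And>x y. [crd (x \<otimes>\<^bsub>G\<^esub> y) i = crd x i + crd y i] (mod m)"
    and m: "m dvd (int p)\<^sup>2" and i: "i < n" and x: "x \<in> derived G (carrier G)"
  shows "[crd x i = 0] (mod m)"
proof -
  let ?K = "{x \<in> carrier G. [crd x i = 0] (mod m)}"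
  have "subgroup ?K G"
  proof (rule subgroupI)
    show "?K \<noteq> {}"
      using cong_dvd_mono_modulus[OF crd_one[OF i] m] by blast
  next
    fix a assume "a \<in> ?K"
    then show "inv\<^bsub>G\<^esub> a \<in> ?K"
      using cong_trans[OF crd_inv[OF add m i, of a], of 0] by (auto simp: cong_0_iff)
  next
    fix a b assume "a \<in> ?K" "b \<in> ?K"
    then show "a \<otimes>\<^bsub>G\<^esub> b \<in> ?K"
      using cong_trans[OF add cong_add[of "crd a i" 0 m "crd b i" 0]] by auto
  qed auto
  moreover have "derived_set G (carrier G) \<subseteq> ?K"
  proof clarify
    fix a b assume ab: "a \<in> carrier G" "b \<in> carrier G"
    have "[crd (a \<otimes>\<^bsub>G\<^esub> b \<otimes>\<^bsub>G\<^esub> inv\<^bsub>G\<^esub> a \<otimes>\<^bsub>G\<^esub> inv\<^bsub>G\<^esub> b) i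
        = crd a i + crd b i + - crd a i + - crd b i] (mod m)"
      by (intro cong_trans[OF add] cong_add crd_inv[OF add m i] ab cong_refl)
    then show "a \<otimes>\<^bsub>G\<^esub> b \<otimes>\<^bsub>G\<^esub> inv\<^bsub>G\<^esub> a \<otimes>\<^bsub>G\<^esub> inv\<^bsub>G\<^esub> b \<in> carrier G \<and>
        [crd (a \<otimes>\<^bsub>G\<^esub> b \<otimes>\<^bsub>G\<^esub> inv\<^bsub>G\<^esub> a \<otimes>\<^bsub>G\<^esub> inv\<^bsub>G\<^esub> b) i = 0] (mod m)"
      using ab by simp
  qed
  ultimately have "derived G (carrier G) \<subseteq> ?K"
    unfolding derived_def by (intro generate_subgroup_incl) auto
  then show ?thesis using x by auto
qed

section \<open>The central subgroup of \<open>p\<close>-th powers\<close>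

lemma derived_subset_pV: "derived G (carrier G) \<subseteq> pV"
  using derived_crd[OF crd_mult_p] derived_in_carrier[of "carrier G"] by (auto simp: pV_def)

lemma subgroup_pV: "subgroup pV G"
proof (rule subgroupI)
  show "pV \<noteq> {}"
    using crd_one_p by (auto simp: pV_def intro!: exI[of _ "\<one>\<^bsub>G\<^esub>"])
next
  fix a assume a: "a \<in> pV"
  then show "inv\<^bsub>G\<^esub> a \<in> pV"
    using cong_trans[OF crd_inv_p[of _ a], of _ 0] by (auto simp: pV_def cong_0_iff)
next
  fix a b assume "a \<in> pV" "b \<in> pV"
  then show "a \<otimes>\<^bsub>G\<^esub> b \<in> pV"
    using cong_trans[OF crd_mult_p cong_add[of "crd a _" 0 "int p" "crd b _" 0]] by (auto simp: pV_def)
qed (auto simp: pV_def)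

lemma beta_zero:
  assumes "\<And>j k. j < n \<Longrightarrow> k < j \<Longrightarrow> [x j * y k = 0] (mod m)"
  shows "[\<beta> i x y = 0] (mod m)"
  unfolding \<beta>_def cong_0_iff using assms
  by (intro dvd_sum) (auto simp: cong_0_iff mult.assoc)

text \<open>If one argument of \<beta> is divisible by \<open>p\<close>, the correction vanishes
  modulo \<open>p^2\<close> and the product is plain addition.\<close>

lemma pV_central:
  assumes z: "z \<in> pV" and x: "x \<in> carrier G"
  shows "z \<otimes>\<^bsub>G\<^esub> x = x \<otimes>\<^bsub>G\<^esub> z"
proof (rule crd_eqI)
  fix i assume i: "i < n"
  have "[\<beta> i (crd z) (crd x) = 0] (mod int p)" "[\<beta> i (crd x) (crd z) = 0] (mod int p)"
    using z by (intro beta_zero; simp add: pV_def cong_0_iff)+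
  then have "[\<beta> i (crd z) (crd x) = \<beta> i (crd x) (crd z)] (mod int p)"
    by (simp add: cong_def)
  then have "[crd z i + crd x i + int p * \<beta> i (crd z) (crd x)
    = crd z i + crd x i + int p * \<beta> i (crd x) (crd z)] (mod (int p)\<^sup>2)"
    by (intro cong_add cong_refl cong_p_mult)
  then show "[crd (z \<otimes>\<^bsub>G\<^esub> x) i = crd (x \<otimes>\<^bsub>G\<^esub> z) i] (mod (int p)\<^sup>2)"
    using crd_mult[OF i, of z x] crd_mult[OF i, of x z] by (simp add: cong_def add.commute)
qed (use z x in \<open>auto simp: pV_def\<close>)

lemma pV_pow:
  assumes "z \<in> pV" shows "z [^]\<^bsub>G\<^esub> p = \<one>\<^bsub>G\<^esub>"
proof (rule crd_eqI)
  fix i assume i: "i < n"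
  have "[int p * crd z i = int p * 0] (mod (int p)\<^sup>2)"
    using assms i by (intro cong_p_mult) (auto simp: pV_def)
  then show "[crd (z [^]\<^bsub>G\<^esub> p) i = crd \<one>\<^bsub>G\<^esub> i] (mod (int p)\<^sup>2)"
    using crd_pow_prime[OF i, of z] crd_one[OF i] by (simp add: cong_def)
qed (use assms in \<open>auto simp: pV_def\<close>)

lemma pow_in_pV:
  assumes "x \<in> carrier G" shows "x [^]\<^bsub>G\<^esub> p \<in> pV"
  using assms cong_p2_imp_p[OF crd_pow_prime[of _ x]] by (auto simp: pV_def cong_def)

lemma pV_root:
  assumes z: "z \<in> pV" shows "\<exists>x\<in>carrier G. z = x [^]\<^bsub>G\<^esub> p"
proof
  \<comment> \<open>Taking \<open>p\<close>-th powers is multiplication by \<open>p\<close>, so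
    exact division of the coordinates gives a root.\<close>
  let ?x = "vec (\<lambda>i. crd z i div int p)"
  show "z = ?x [^]\<^bsub>G\<^esub> p"
  proof (rule crd_eqI)
    fix i assume i: "i < n"
    have "[crd (?x [^]\<^bsub>G\<^esub> p) i = int p * (crd z i div int p)] (mod (int p)\<^sup>2)"
      by (rule cong_trans[OF crd_pow_prime[OF i] cong_p_mult[OF crd_vec_p[OF i]]])
    moreover have "int p * (crd z i div int p) = crd z i"
      using z i by (auto simp: pV_def cong_0_iff)
    ultimately show "[crd z i = crd (?x [^]\<^bsub>G\<^esub> p) i] (mod (int p)\<^sup>2)"
      by (simp add: cong_sym)
  qed (use z in \<open>auto simp: pV_def\<close>)
qed simp

lemma elementary_abelian_pV: "elementary_abelian p (G\<lparr>carrier := pV\<rparr>)"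
proof -
  interpret V: group "G\<lparr>carrier := pV\<rparr>"
    by (rule subgroup_imp_group[OF subgroup_pV])
  have "comm_group (G\<lparr>carrier := pV\<rparr>)"
    using pV_central by (intro V.group_comm_groupI) (auto simp: pV_def)
  moreover have "x [^]\<^bsub>G\<lparr>carrier := pV\<rparr>\<^esub> p = \<one>\<^bsub>G\<^esub>" if "x \<in> pV" for x
    using pV_pow[OF that] by (simp flip: nat_pow_consistent)
  ultimately show ?thesis
    using prime_p by (simp add: elementary_abelian_def)
qed

section \<open>Maximal subgroups and the Frattini subgroup\<close>

text \<open>The set is the kernel of coordinate \<open>i\<close> as a homomorphism onto the field
  with \<open>p\<close> elements. An element outside it has an invertible coordinate, so a suitable
  power of it moves any \<open>g\<close> into the kernel.\<close>

lemma maximal_coordinate_subgroup: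
  assumes i: "i < n"
  shows "maximal_subgroup {x \<in> carrier G. [crd x i = 0] (mod int p)} G" (is "maximal_subgroup ?M G")
  unfolding maximal_subgroup_def
proof (intro conjI allI impI)
  show "subgroup ?M G"
  proof (rule subgroupI)
    show "?M \<noteq> {}"
      using crd_one_p[OF i] by blast
  next
    fix a assume "a \<in> ?M"
    then show "inv\<^bsub>G\<^esub> a \<in> ?M"
      using cong_trans[OF crd_inv_p[OF i, of a], of 0] by (auto simp: cong_0_iff)
  next
    fix a b assume "a \<in> ?M" "b \<in> ?M"
    then show "a \<otimes>\<^bsub>G\<^esub> b \<in> ?M"
      using cong_trans[OF crd_mult_p[OF i] cong_add[of "crd a i" 0 "int p" "crd b i" 0]] by auto
  qed auto
  have "\<not> [crd (e i) i = 0] (mod int p)"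
    using crd_e_p[OF i, of i] prime_gt_1_nat[OF prime_p] by (auto simp: cong_def)
  then show "?M \<noteq> carrier G"
    using e_closed by blast
next
  fix H assume H: "subgroup H G" and M: "?M \<subseteq> H"
  interpret H: subgroup H G by (rule H)
  show "H = ?M \<or> H = carrier G"
  proof (rule disjCI)
    assume "H \<noteq> carrier G"
    have False if x: "x \<in> H" "\<not> [crd x i = 0] (mod int p)" for x
    proof -
      have "coprime (crd x i) (int p)"
        using x(2) prime_imp_coprime[of "int p" "crd x i"] prime_p
        by (simp add: cong_0_iff coprime_commute)
      then obtain u where u: "[crd x i * u = 1] (mod int p)"
        using cong_solve_coprime_int by blast
      have "g \<in> H" if g: "g \<in> carrier G" for g
      proof -
        \<comment> \<open>The exponent makes coordinate \<open>i\<close> of \<open>g\<close> times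
          the \<open>k\<close>-th power of \<open>x\<close> vanish modulo \<open>p\<close>.\<close>
        define k where "k = nat ((- crd g i * u) mod int p)"
        have "[int k = - crd g i * u] (mod int p)"
          using p_gt_0 by (simp add: k_def cong_def)
        then have "[int k * crd x i = - crd g i * u * crd x i] (mod int p)"
          by (intro cong_mult cong_refl)
        also have "[- crd g i * u * crd x i = - crd g i * 1] (mod int p)"
          using cong_mult[OF cong_refl u, of "- crd g i"] by (simp add: ac_simps)
        finally have "[crd g i + crd (x [^]\<^bsub>G\<^esub> k) i = crd g i + - crd g i * 1] (mod int p)"
          by (intro cong_add cong_refl cong_trans[OF crd_pow_p[OF i]])
        then have "[crd (g \<otimes>\<^bsub>G\<^esub> x [^]\<^bsub>G\<^esub> k) i = 0] (mod int p)"
          using cong_trans[OF crd_mult_p[OF i]] by simp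
        then have "g \<otimes>\<^bsub>G\<^esub> x [^]\<^bsub>G\<^esub> k \<in> H"
          using M g x(1) by auto
        moreover have "x [^]\<^bsub>G\<^esub> k \<in> H"
          using x(1) by (induction k) auto
        ultimately have "g \<otimes>\<^bsub>G\<^esub> x [^]\<^bsub>G\<^esub> k \<otimes>\<^bsub>G\<^esub> inv\<^bsub>G\<^esub> (x [^]\<^bsub>G\<^esub> k) \<in> H"
          by blast
        then show ?thesis
          using g x(1) by (simp add: m_assoc)
      qed
      then show False
        using \<open>H \<noteq> carrier G\<close> H.subset by blast
    qed
    then show "H = ?M"
      using M by auto
  qed
qed

text \<open>The coordinate kernels intersect in \<open>pV\<close>. Conversely, if a maximal subgroup
  \<open>M\<close> missed some \<open>z\<close> in the central subgroup \<open>pV\<close>, then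
  \<open>M\<close> and \<open>pV\<close> would together give all of \<open>G\<close>. Writing
  \<open>z = x^p\<close> and \<open>x = m v\<close> yields \<open>z = m^p v^p = m^p\<close>, which
  lies in \<open>M\<close>.\<close>

lemma frattini_eq_pV: "frattini G = pV"
proof
  show "frattini G \<subseteq> pV"
    using maximal_coordinate_subgroup by (fastforce simp: frattini_def pV_def)
next
  have "z \<in> M" if z: "z \<in> pV" and M: "maximal_subgroup M G" for z M
  proof (rule ccontr)
    assume "z \<notin> M"
    interpret M: subgroup M G using M by (simp add: maximal_subgroup_def)
    interpret V: subgroup pV G by (rule subgroup_pV)
    let ?H = "{m \<otimes>\<^bsub>G\<^esub> v | m v. m \<in> M \<and> v \<in> pV}"
    have "subgroup ?H G"
    proof (rule subgroupI)
      show "?H \<noteq> {}"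
        using M.one_closed V.one_closed by blast
    next
      fix a assume "a \<in> ?H"
      then obtain m v where "a = m \<otimes>\<^bsub>G\<^esub> v" "m \<in> M" "v \<in> pV" by auto
      then show "inv\<^bsub>G\<^esub> a \<in> ?H"
        using pV_central[of "inv\<^bsub>G\<^esub> v" "inv\<^bsub>G\<^esub> m"] by (force simp: inv_mult_group)
    next
      fix a b assume "a \<in> ?H" "b \<in> ?H"
      then obtain m v m' v' where ab: "a = m \<otimes>\<^bsub>G\<^esub> v" "m \<in> M" "v \<in> pV" "b = m' \<otimes>\<^bsub>G\<^esub> v'" "m' \<in> M" "v' \<in> pV"
        by auto
      then have "a \<otimes>\<^bsub>G\<^esub> b = m \<otimes>\<^bsub>G\<^esub> (v \<otimes>\<^bsub>G\<^esub> m') \<otimes>\<^bsub>G\<^esub> v'"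
        by (simp add: m_assoc)
      also have "\<dots> = (m \<otimes>\<^bsub>G\<^esub> m') \<otimes>\<^bsub>G\<^esub> (v \<otimes>\<^bsub>G\<^esub> v')"
        using ab by (simp add: m_assoc pV_central)
      finally show "a \<otimes>\<^bsub>G\<^esub> b \<in> ?H"
        using ab by blast
    qed auto
    moreover have "M \<subseteq> ?H"
    proof
      fix m assume "m \<in> M"
      then have "m = m \<otimes>\<^bsub>G\<^esub> \<one>\<^bsub>G\<^esub>" by simp
      then show "m \<in> ?H"
        using \<open>m \<in> M\<close> V.one_closed by blast
    qed
    moreover have "\<one>\<^bsub>G\<^esub> \<otimes>\<^bsub>G\<^esub> z \<in> ?H"
      using M.one_closed z by (intro CollectI exI[of _ "\<one>\<^bsub>G\<^esub>"] exI[of _ z]) simp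
    then have "z \<in> ?H"
      unfolding l_one[OF V.mem_carrier[OF z]] .
    ultimately have H: "?H = carrier G"
      using M \<open>z \<notin> M\<close> unfolding maximal_subgroup_def by blast
    obtain x where x: "x \<in> carrier G" "z = x [^]\<^bsub>G\<^esub> p"
      using pV_root[OF z] by blast
    then obtain m v where mv: "x = m \<otimes>\<^bsub>G\<^esub> v" "m \<in> M" "v \<in> pV"
      using H by blast
    have "z = m [^]\<^bsub>G\<^esub> p \<otimes>\<^bsub>G\<^esub> v [^]\<^bsub>G\<^esub> p"
      unfolding x mv using mv by (intro pow_mult_distrib) (auto simp: pV_central)
    then have "z = m [^]\<^bsub>G\<^esub> p"
      using mv by (simp add: pV_pow)
    moreover have "m [^]\<^bsub>G\<^esub> k \<in> M" for k :: nat
      using mv(2) by (induction k) auto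
    ultimately show False
      using \<open>z \<notin> M\<close> by simp
  qed
  then show "pV \<subseteq> frattini G"
    by (auto simp: frattini_def pV_def)
qed

section \<open>Generators and automorphisms\<close>

text \<open>Every element is an ordered product of powers of \<open>e 0\<close>, ...,
  \<open>e (n - 1)\<close>. The induction on \<open>k\<close> concerns elements whose coordinates
  from \<open>k\<close> on vanish; its step splits off a power of \<open>e k\<close> on the
  right.\<close>

lemma subgroup_eq_carrier:
  assumes H: "subgroup H G" and e: "\<And>j. j < n \<Longrightarrow> e j \<in> H"
  shows "H = carrier G"
proof -
  interpret H: subgroup H G by (rule H)
  have "x \<in> H" if "k \<le> n" "x \<in> carrier G" "\<And>i. i < n \<Longrightarrow> k \<le> i \<Longrightarrow> [crd x i = 0] (mod (int p)\<^sup>2)" for k x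
    using that
  proof (induction k arbitrary: x)
    case 0
    then have "x = \<one>\<^bsub>G\<^esub>"
      using crd_one by (intro crd_eqI) (auto simp: cong_def)
    then show ?case by simp
  next
    case (Suc k)
    then have k: "k < n" by simp
    define y where "y = vec (\<lambda>i. if i = k then 0 else crd x i)"
    have crd_y: "[crd y i = (if i = k then 0 else crd x i)] (mod (int p)\<^sup>2)" if "i < n" for i
      using crd_vec[OF that, of "\<lambda>i. if i = k then 0 else crd x i"] by (simp add: y_def)
    have y0: "[crd y i = 0] (mod (int p)\<^sup>2)" if "i < n" "k \<le> i" for i
      using cong_trans[OF crd_y[OF that(1)]] Suc.prems(3)[OF that(1)] that by auto
    then have "y \<in> H"
      using k by (intro Suc.IH) (auto simp: y_def)
    define m where "m = nat (crd x k mod (int p)\<^sup>2)"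
    have m: "[int m = crd x k] (mod (int p)\<^sup>2)"
      using p_gt_0 by (simp add: m_def cong_def)
    have "x = y \<otimes>\<^bsub>G\<^esub> e k [^]\<^bsub>G\<^esub> m"
    proof (rule crd_eqI)
      fix i assume i: "i < n"
      \<comment> \<open>Only pairs of distinct indices enter \<beta>, whereas \<open>e k\<close> is
        supported at \<open>k\<close> alone.\<close>
      have "[\<beta> i (crd (e k)) (crd (e k)) = 0] (mod int p)"
      proof (rule beta_zero)
        fix j l assume "j < n" "l < j"
        then show "[crd (e k) j * crd (e k) l = 0] (mod int p)"
          using cong_mult[OF crd_e_p[of j k] crd_e_p[of l k]] by (auto split: if_splits)
      qed
      then have "[int (m choose 2) * \<beta> i (crd (e k)) (crd (e k)) = 0] (mod int p)"
        by (simp add: cong_0_iff)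
      from cong_trans[OF crd_pow[OF i] cong_add[OF cong_refl cong_p_mult[OF this]]]
      have *: "[crd (e k [^]\<^bsub>G\<^esub> m) i = int m * crd (e k) i] (mod (int p)\<^sup>2)" by simp
      have **: "[crd (e k [^]\<^bsub>G\<^esub> m) i = (if i = k then crd x k else 0)] (mod (int p)\<^sup>2)"
        using cong_trans[OF * cong_mult[OF m crd_e[OF i]]] by (auto split: if_splits)
      \<comment> \<open>A contributing pair \<open>(j, l)\<close> needs \<open>l = k\<close>, hence
        \<open>j > k\<close>, where the coordinates of \<open>y\<close> vanish.\<close>
      have "[\<beta> i (crd y) (crd (e k [^]\<^bsub>G\<^esub> m)) = 0] (mod int p)"
      proof (rule beta_zero)
        fix j l assume jl: "j < n" "l < j"
        show "[crd y j * crd (e k [^]\<^bsub>G\<^esub> m) l = 0] (mod int p)"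
        proof (cases "l = k")
          case True
          then show ?thesis using cong_p2_imp_p[OF y0[OF jl(1)]] jl by (auto simp: cong_0_iff)
        next
          case False
          have "[crd (e k [^]\<^bsub>G\<^esub> m) l = int m * 0] (mod int p)"
            using crd_e_p[of l k] jl False
            by (intro cong_trans[OF crd_pow_p] cong_mult) auto
          then show ?thesis by (auto simp: cong_0_iff)
        qed
      qed
      from cong_p_mult[OF this]
      have "[crd y i + crd (e k [^]\<^bsub>G\<^esub> m) i + int p * \<beta> i (crd y) (crd (e k [^]\<^bsub>G\<^esub> m))
        = (if i = k then 0 else crd x i) + (if i = k then crd x k else 0) + int p * 0] (mod (int p)\<^sup>2)"
        by (intro cong_add crd_y i **)
      from cong_trans[OF crd_mult[OF i] this]
      show "[crd x i = crd (y \<otimes>\<^bsub>G\<^esub> e k [^]\<^bsub>G\<^esub> m) i] (mod (int p)\<^sup>2)"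
        by (cases "i = k") (simp_all add: cong_sym)
    qed (use Suc.prems in \<open>auto simp: y_def\<close>)
    moreover have "e k [^]\<^bsub>G\<^esub> l \<in> H" for l :: nat
      using e[OF k] by (induction l) auto
    ultimately show ?case
      using \<open>y \<in> H\<close> by auto
  qed
  from this[of n] show ?thesis
    using H.subset by force
qed

lemma auto_closed: "\<alpha> \<in> auto G \<Longrightarrow> x \<in> carrier G \<Longrightarrow> \<alpha> x \<in> carrier G"
  by (auto simp: auto_def hom_def)

lemma auto_mult:
  "\<alpha> \<in> auto G \<Longrightarrow> x \<in> carrier G \<Longrightarrow> y \<in> carrier G \<Longrightarrow> \<alpha> (x \<otimes>\<^bsub>G\<^esub> y) = \<alpha> x \<otimes>\<^bsub>G\<^esub> \<alpha> y"
  by (simp add: auto_def hom_def)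

lemma auto_group_hom: "\<alpha> \<in> auto G \<Longrightarrow> group_hom G G \<alpha>"
  by (simp add: auto_def group_hom_def group_hom_axioms_def is_group)

lemma auto_pow:
  "\<alpha> \<in> auto G \<Longrightarrow> x \<in> carrier G \<Longrightarrow> \<alpha> (x [^]\<^bsub>G\<^esub> (k :: nat)) = \<alpha> x [^]\<^bsub>G\<^esub> k"
  using group_hom.hom_nat_pow[OF auto_group_hom] by metis

lemma pV_difference:
  assumes x: "x \<in> carrier G" and y: "y \<in> carrier G"
    and eq: "\<And>i. i < n \<Longrightarrow> [crd y i = crd x i] (mod int p)"
  obtains z where "z \<in> pV" "y = x \<otimes>\<^bsub>G\<^esub> z"
proof
  have "[crd (inv\<^bsub>G\<^esub> x \<otimes>\<^bsub>G\<^esub> y) i = - crd x i + crd x i] (mod int p)" if "i < n" for i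
    by (intro cong_trans[OF crd_mult_p] cong_add crd_inv_p that eq x)
  then show "inv\<^bsub>G\<^esub> x \<otimes>\<^bsub>G\<^esub> y \<in> pV"
    using x y by (simp add: pV_def)
  show "y = x \<otimes>\<^bsub>G\<^esub> (inv\<^bsub>G\<^esub> x \<otimes>\<^bsub>G\<^esub> y)"
    using x y by (simp flip: m_assoc)
qed

text \<open>The elements on which both maps agree form a subgroup; extensionality settles the values
  off the carrier.\<close>

lemma auto_eqI:
  assumes \<alpha>: "\<alpha> \<in> auto G" and \<alpha>': "\<alpha>' \<in> auto G" and e: "\<And>j. j < n \<Longrightarrow> \<alpha> (e j) = \<alpha>' (e j)"
  shows "\<alpha> = \<alpha>'"
proof -
  interpret A: group_hom G G \<alpha> by (rule auto_group_hom[OF \<alpha>])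
  interpret A': group_hom G G \<alpha>' by (rule auto_group_hom[OF \<alpha>'])
  have "subgroup {x \<in> carrier G. \<alpha> x = \<alpha>' x} G"
    by (rule subgroupI) auto
  then have "{x \<in> carrier G. \<alpha> x = \<alpha>' x} = carrier G"
    by (rule subgroup_eq_carrier) (simp add: e)
  moreover have "\<alpha> \<in> extensional (carrier G)" "\<alpha>' \<in> extensional (carrier G)"
    using \<alpha> \<alpha>' by (simp_all add: auto_def Bij_def)
  ultimately show ?thesis
    by (auto intro!: extensionalityI)
qed

text \<open>Coordinate \<open>i\<close> modulo \<open>p\<close> is a homomorphism, so the elements
  for which \<alpha> preserves it form a subgroup.\<close>

lemma auto_cong:
  assumes \<alpha>: "\<alpha> \<in> auto G" and e: "\<And>i j. i < n \<Longrightarrow> j < n \<Longrightarrow> [crd (\<alpha> (e j)) i = crd (e j) i] (mod int p)"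
    and x: "x \<in> carrier G" and i: "i < n"
  shows "[crd (\<alpha> x) i = crd x i] (mod int p)"
proof -
  interpret A: group_hom G G \<alpha> by (rule auto_group_hom[OF \<alpha>])
  let ?K = "{x \<in> carrier G. [crd (\<alpha> x) i = crd x i] (mod int p)}"
  have "subgroup ?K G"
  proof (rule subgroupI)
    show "?K \<noteq> {}"
      using A.hom_one by (auto intro!: exI[of _ "\<one>\<^bsub>G\<^esub>"])
  next
    fix a assume a: "a \<in> ?K"
    then have "[- crd (\<alpha> a) i = - crd a i] (mod int p)"
      by (simp add: cong_minus_minus_iff)
    then show "inv\<^bsub>G\<^esub> a \<in> ?K"
      using a crd_inv_p[OF i, of a] crd_inv_p[OF i, of "\<alpha> a"] by (simp add: cong_def)
  next
    fix a b assume ab: "a \<in> ?K" "b \<in> ?K"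
    then have "[crd (\<alpha> a) i + crd (\<alpha> b) i = crd a i + crd b i] (mod int p)"
      by (intro cong_add) auto
    then show "a \<otimes>\<^bsub>G\<^esub> b \<in> ?K"
      using ab crd_mult_p[OF i, of a b] crd_mult_p[OF i, of "\<alpha> a" "\<alpha> b"] by (simp add: cong_def)
  qed auto
  then have "?K = carrier G"
    by (rule subgroup_eq_carrier) (simp add: e i)
  then show ?thesis using x by blast
qed

section \<open>Lifting prescribed images of the generators\<close>

text \<open>The class of \<open>y\<close> modulo \<open>pV\<close> is parametrized by
  \<open>y + p f\<close> with digits \<open>f i\<close> between 0 and \<open>p - 1\<close>.\<close>

lemma card_congruent:
  assumes y: "y \<in> carrier G"
  shows "card {x \<in> carrier G. \<forall>i<n. [crd x i = crd y i] (mod int p)} = p ^ n"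
proof -
  let ?F = "\<lambda>f. vec (\<lambda>i. crd y i + int p * f i)" and ?S = "{..<n} \<rightarrow>\<^sub>E {0..<int p}"
  have crdF: "i < n \<Longrightarrow> [crd (?F f) i = crd y i + int p * f i] (mod (int p)\<^sup>2)" for f i
    by (rule crd_vec)
  have "bij_betw ?F ?S {x \<in> carrier G. \<forall>i<n. [crd x i = crd y i] (mod int p)}"
    unfolding bij_betw_def
  proof
    show "inj_on ?F ?S"
    proof (rule inj_onI)
      fix f g assume f: "f \<in> ?S" and g: "g \<in> ?S" and eq: "?F f = ?F g"
      have "f i = g i" if i: "i < n" for i
      proof -
        have "[crd y i + int p * f i = crd y i + int p * g i] (mod (int p)\<^sup>2)"
          using crdF[OF i, of f] crdF[OF i, of g] unfolding eq by (simp add: cong_def)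
        then have "[f i = g i] (mod int p)"
          by (simp add: cong_add_lcancel cong_p_mult_iff)
        moreover have "f i \<in> {0..<int p}" "g i \<in> {0..<int p}"
          using PiE_mem[OF f, of i] PiE_mem[OF g, of i] i by simp_all
        ultimately show ?thesis
          by (simp add: cong_def)
      qed
      then show "f = g"
        using f g by (intro PiE_ext[of f]) auto
    qed
    show "?F ` ?S = {x \<in> carrier G. \<forall>i<n. [crd x i = crd y i] (mod int p)}" (is "_ = ?C")
    proof
      have "[crd y i + int p * f i = crd y i] (mod int p)" for f i
        by (simp add: cong_iff_dvd_diff)
      then show "?F ` ?S \<subseteq> ?C"
        by (auto intro: cong_trans[OF crd_vec_p])
    next
      show "?C \<subseteq> ?F ` ?S"
      proof
        fix x assume x: "x \<in> ?C"
        define f where "f = (\<lambda>i\<in>{..<n}. (crd x i - crd y i) div int p mod int p)"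
        have "x = ?F f"
        proof (rule crd_eqI)
          fix i assume i: "i < n"
          have "[f i = (crd x i - crd y i) div int p] (mod int p)"
            using i by (simp add: f_def)
          then have "[crd y i + int p * f i = crd y i + int p * ((crd x i - crd y i) div int p)] (mod (int p)\<^sup>2)"
            by (intro cong_add cong_refl cong_p_mult)
          moreover have "int p * ((crd x i - crd y i) div int p) = crd x i - crd y i"
            using x i by (simp add: cong_iff_dvd_diff)
          ultimately show "[crd x i = crd (?F f) i] (mod (int p)\<^sup>2)"
            using cong_trans[OF crdF[OF i]] by (simp add: cong_sym)
        qed (use x in auto)
        moreover have "f \<in> ?S"
          using p_gt_0 by (auto simp: f_def)
        ultimately show "x \<in> ?F ` ?S"
          by blast
      qed
    qed
  qed
  then have "card {x \<in> carrier G. \<forall>i<n. [crd x i = crd y i] (mod int p)} = card ?S"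
    by (simp add: bij_betw_same_card)
  then show ?thesis
    by (simp add: card_PiE)
qed

text \<open>The map is \<open>x + p s(x)\<close>, with \<open>s\<close> linear and matrix
  \<open>D\<close>. It is the identity modulo \<open>p\<close>, so it leaves \<beta> alone and
  multiplicativity reduces to additivity of \<open>s\<close>. Equal images agree modulo
  \<open>p\<close>, hence have the same \<open>s\<close> modulo \<open>p\<close>, hence are equal;
  finiteness gives surjectivity.\<close>

lemma auto_extension:
  assumes h: "\<And>j. j < n \<Longrightarrow> h j \<in> carrier G"
    and he: "\<And>i j. i < n \<Longrightarrow> j < n \<Longrightarrow> [crd (h j) i = crd (e j) i] (mod int p)"
  obtains \<alpha> where "\<alpha> \<in> auto G" "\<And>j. j < n \<Longrightarrow> \<alpha> (e j) = h j"
proof -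
  define D where "D j i = (crd (h j) i - crd (e j) i) div int p" for i j
  have D: "int p * D j i = crd (h j) i - crd (e j) i" if "i < n" "j < n" for i j
    using he[OF that] by (simp add: D_def cong_iff_dvd_diff)
  define s where "s x i = (\<Sum>j<n. x j * D j i)" for x :: "nat \<Rightarrow> int" and i
  have s_cong: "[s x i = s x' i] (mod int p)" if "\<And>j. j < n \<Longrightarrow> [x j = x' j] (mod int p)" for x x' i
    unfolding s_def using that by (intro cong_sum cong_mult cong_refl) auto
  define \<alpha> where "\<alpha> = (\<lambda>x\<in>carrier G. vec (\<lambda>i. crd x i + int p * s (crd x) i))"
  have crd_\<alpha>: "[crd (\<alpha> x) i = crd x i + int p * s (crd x) i] (mod (int p)\<^sup>2)"
    if "x \<in> carrier G" "i < n" for x i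
    using that crd_vec by (simp add: \<alpha>_def)
  have crd_\<alpha>_p: "[crd (\<alpha> x) i = crd x i] (mod int p)" if "x \<in> carrier G" "i < n" for x i
    using cong_p2_imp_p[OF crd_\<alpha>[OF that]] by (simp add: cong_def)
  have closed: "\<alpha> x \<in> carrier G" if "x \<in> carrier G" for x
    using that by (simp add: \<alpha>_def)
  have "\<alpha> (x \<otimes>\<^bsub>G\<^esub> y) = \<alpha> x \<otimes>\<^bsub>G\<^esub> \<alpha> y" if x: "x \<in> carrier G" and y: "y \<in> carrier G" for x y
  proof (rule crd_eqI)
    fix i assume i: "i < n"
    have "[s (crd (x \<otimes>\<^bsub>G\<^esub> y)) i = s (\<lambda>j. crd x j + crd y j) i] (mod int p)"
      by (intro s_cong crd_mult_p)
    also have "s (\<lambda>j. crd x j + crd y j) i = s (crd x) i + s (crd y) i"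
      by (simp add: s_def sum.distrib algebra_simps)
    finally have "[crd (x \<otimes>\<^bsub>G\<^esub> y) i + int p * s (crd (x \<otimes>\<^bsub>G\<^esub> y)) i
        = (crd x i + crd y i + int p * \<beta> i (crd x) (crd y)) + int p * (s (crd x) i + s (crd y) i)] (mod (int p)\<^sup>2)"
      by (intro cong_add crd_mult i cong_p_mult)
    then have 1: "[crd (\<alpha> (x \<otimes>\<^bsub>G\<^esub> y)) i
        = (crd x i + crd y i + int p * \<beta> i (crd x) (crd y)) + int p * (s (crd x) i + s (crd y) i)] (mod (int p)\<^sup>2)"
      using x y i by (intro cong_trans[OF crd_\<alpha>]) auto
    have "[\<beta> i (crd (\<alpha> x)) (crd (\<alpha> y)) = \<beta> i (crd x) (crd y)] (mod int p)"
      using x y by (intro beta_cong crd_\<alpha>_p)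
    then have "[crd (\<alpha> x) i + crd (\<alpha> y) i + int p * \<beta> i (crd (\<alpha> x)) (crd (\<alpha> y))
       = (crd x i + int p * s (crd x) i) + (crd y i + int p * s (crd y) i) + int p * \<beta> i (crd x) (crd y)] (mod (int p)\<^sup>2)"
      by (intro cong_add crd_\<alpha> x y i cong_p_mult)
    from cong_trans[OF crd_mult[OF i] this] 1
    show "[crd (\<alpha> (x \<otimes>\<^bsub>G\<^esub> y)) i = crd (\<alpha> x \<otimes>\<^bsub>G\<^esub> \<alpha> y) i] (mod (int p)\<^sup>2)"
      by (simp add: cong_def algebra_simps)
  qed (use x y closed in auto)
  then have hom: "\<alpha> \<in> hom G G"
    using closed by (auto simp: hom_def)
  have "inj_on \<alpha> (carrier G)"
  proof (rule inj_onI)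
    fix x y assume x: "x \<in> carrier G" and y: "y \<in> carrier G" and eq: "\<alpha> x = \<alpha> y"
    have "[crd x i = crd y i] (mod int p)" if "i < n" for i
      using crd_\<alpha>_p[OF x that] crd_\<alpha>_p[OF y that] unfolding eq by (simp add: cong_def)
    then have s: "[s (crd x) i = s (crd y) i] (mod int p)" for i
      by (rule s_cong)
    show "x = y"
    proof (rule crd_eqI[OF x y])
      fix i assume i: "i < n"
      have "[crd x i + int p * s (crd x) i = crd y i + int p * s (crd y) i] (mod (int p)\<^sup>2)"
        using crd_\<alpha>[OF x i] crd_\<alpha>[OF y i] unfolding eq by (simp add: cong_def)
      from cong_diff[OF this cong_p_mult[OF s[of i]]]
      show "[crd x i = crd y i] (mod (int p)\<^sup>2)" by simp
    qed
  qed
  moreover have "\<alpha> ` carrier G \<subseteq> carrier G"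
    using closed by blast
  ultimately have "bij_betw \<alpha> (carrier G) (carrier G)"
    using endo_inj_surj[OF finite_G] by (simp add: bij_betw_def)
  then have "\<alpha> \<in> auto G"
    using hom by (simp add: auto_def Bij_def \<alpha>_def)
  moreover have "\<alpha> (e j) = h j" if j: "j < n" for j
  proof (rule crd_eqI)
    fix i assume i: "i < n"
    have "[s (crd (e j)) i = s (\<lambda>k. if k = j then 1 else 0) i] (mod int p)"
      by (intro s_cong crd_e_p)
    also have "s (\<lambda>k. if k = j then 1 else 0) i = D j i"
      using j by (simp add: s_def if_distrib[of "\<lambda>x. x * _"] sum.delta cong: if_cong)
    finally have "[crd (e j) i + int p * s (crd (e j)) i = crd (e j) i + int p * D j i] (mod (int p)\<^sup>2)"
      by (intro cong_add cong_refl cong_p_mult)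
    then show "[crd (\<alpha> (e j)) i = crd (h j) i] (mod (int p)\<^sup>2)"
      using cong_trans[OF crd_\<alpha>[OF e_closed i]] D[OF i j] by simp
  qed (use closed h[OF j] in auto)
  ultimately show ?thesis
    using that by blast
qed

section \<open>The automorphism group in the rigid case\<close>

text \<open>The hypothesis says that automorphisms induce the identity on \<open>V\<close>;
  \<open>auto_trivial_mod_p\<close> establishes it for the concrete algebra.\<close>

context
  assumes rigid: "\<And>\<alpha> i j. \<alpha> \<in> auto G \<Longrightarrow> i < n \<Longrightarrow> j < n \<Longrightarrow>
    [crd (\<alpha> (e j)) i = crd (e j) i] (mod int p)"
begin

lemma auto_translate:
  assumes "\<alpha> \<in> auto G" "x \<in> carrier G"
  obtains z where "z \<in> pV" "\<alpha> x = x \<otimes>\<^bsub>G\<^esub> z"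
  using pV_difference[OF assms(2) auto_closed[OF assms] auto_cong[OF assms(1) rigid[OF assms(1)] assms(2)]]
  by blast

text \<open>With \<open>z = x^p\<close> and \<open>\<alpha> x = x v\<close>, the factor
  \<open>v\<close> is central and \<open>v^p = 1\<close>, so the image of \<open>z\<close> is
  \<open>(x v)^p = x^p\<close>.\<close>

lemma auto_fixes_pV:
  assumes "\<alpha> \<in> auto G" "z \<in> pV"
  shows "\<alpha> z = z"
proof -
  obtain x where x: "x \<in> carrier G" "z = x [^]\<^bsub>G\<^esub> p"
    using pV_root[OF assms(2)] by blast
  obtain v where v: "v \<in> pV" "\<alpha> x = x \<otimes>\<^bsub>G\<^esub> v"
    using auto_translate[OF assms(1) x(1)] by blast
  have "v \<in> carrier G"
    using v(1) by (simp add: pV_def)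
  have "\<alpha> z = (x \<otimes>\<^bsub>G\<^esub> v) [^]\<^bsub>G\<^esub> p"
    using auto_pow[OF assms(1) x(1)] x(2) v(2) by simp
  also have "\<dots> = x [^]\<^bsub>G\<^esub> p \<otimes>\<^bsub>G\<^esub> v [^]\<^bsub>G\<^esub> p"
    using x \<open>v \<in> carrier G\<close> pV_central[OF v(1) x(1)] by (intro pow_mult_distrib) auto
  finally show ?thesis
    using x v(1) by (simp add: pV_pow)
qed

text \<open>Each automorphism multiplies \<open>x\<close> by an element of \<open>pV\<close> and
  fixes \<open>pV\<close> pointwise. Composition therefore multiplies these factors, which commute
  and have trivial \<open>p\<close>-th power.\<close>

lemma elementary_abelian_Auto: "elementary_abelian p (AutoGroup G)"
proof -
  interpret A: group "AutoGroup G" by (rule AutoGroup)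
  have carrier: "carrier (AutoGroup G) = auto G"
    by (simp add: AutoGroup_def)
  have ext: "\<alpha> \<in> extensional (carrier G)" if "\<alpha> \<in> auto G" for \<alpha>
    using that by (simp add: auto_def Bij_def)
  have mult: "(\<alpha> \<otimes>\<^bsub>AutoGroup G\<^esub> \<alpha>') x = \<alpha> (\<alpha>' x)"
    if "\<alpha> \<in> auto G" "\<alpha>' \<in> auto G" "x \<in> carrier G" for \<alpha> \<alpha>' x
    using that by (simp add: AutoGroup_def BijGroup_def auto_def compose_def)
  have one: "\<one>\<^bsub>AutoGroup G\<^esub> x = x" if "x \<in> carrier G" for x
    using that by (simp add: AutoGroup_def BijGroup_def)
  have pVc: "z \<in> carrier G" if "z \<in> pV" for z
    using that by (simp add: pV_def)
  interpret V: subgroup pV G by (rule subgroup_pV)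
  have "comm_group (AutoGroup G)"
  proof (rule A.group_comm_groupI)
    fix \<alpha> \<alpha>' assume "\<alpha> \<in> carrier (AutoGroup G)" "\<alpha>' \<in> carrier (AutoGroup G)"
    then have A: "\<alpha> \<in> auto G" "\<alpha>' \<in> auto G"
      by (simp_all add: carrier)
    have "\<alpha> (\<alpha>' x) = \<alpha>' (\<alpha> x)" if x: "x \<in> carrier G" for x
    proof -
      obtain z where z: "z \<in> pV" "\<alpha> x = x \<otimes>\<^bsub>G\<^esub> z"
        using auto_translate[OF A(1) x] by blast
      obtain z' where z': "z' \<in> pV" "\<alpha>' x = x \<otimes>\<^bsub>G\<^esub> z'"
        using auto_translate[OF A(2) x] by blast
      have "\<alpha> (\<alpha>' x) = x \<otimes>\<^bsub>G\<^esub> z \<otimes>\<^bsub>G\<^esub> z'" "\<alpha>' (\<alpha> x) = x \<otimes>\<^bsub>G\<^esub> z' \<otimes>\<^bsub>G\<^esub> z"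
        using A x z z' pVc by (simp_all add: auto_mult auto_fixes_pV)
      then show ?thesis
        using x z(1) z'(1) pVc pV_central[of z z'] by (simp add: m_assoc)
    qed
    moreover have "\<alpha> \<otimes>\<^bsub>AutoGroup G\<^esub> \<alpha>' \<in> auto G" "\<alpha>' \<otimes>\<^bsub>AutoGroup G\<^esub> \<alpha> \<in> auto G"
      using A A.m_closed by (simp_all add: carrier)
    ultimately show "\<alpha> \<otimes>\<^bsub>AutoGroup G\<^esub> \<alpha>' = \<alpha>' \<otimes>\<^bsub>AutoGroup G\<^esub> \<alpha>"
      by (intro auto_eqI) (simp_all add: mult A)
  qed
  moreover have "\<alpha> [^]\<^bsub>AutoGroup G\<^esub> p = \<one>\<^bsub>AutoGroup G\<^esub>" if a: "\<alpha> \<in> carrier (AutoGroup G)" for \<alpha>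
  proof -
    have \<alpha>: "\<alpha> \<in> auto G"
      using that by (simp add: carrier)
    have pow: "\<alpha> [^]\<^bsub>AutoGroup G\<^esub> k \<in> auto G" for k :: nat
      using A.nat_pow_closed[OF a] by (simp add: carrier)
    have iter: "(\<alpha> [^]\<^bsub>AutoGroup G\<^esub> k) x = x \<otimes>\<^bsub>G\<^esub> z [^]\<^bsub>G\<^esub> k"
      if x: "x \<in> carrier G" and z: "z \<in> pV" "\<alpha> x = x \<otimes>\<^bsub>G\<^esub> z" for x z and k :: nat
    proof (induction k)
      case 0
      then show ?case using x by (simp add: one)
    next
      case (Suc k)
      have zk: "z [^]\<^bsub>G\<^esub> k \<in> pV"
        using z(1) by (induction k) auto
      have "(\<alpha> [^]\<^bsub>AutoGroup G\<^esub> Suc k) x = \<alpha> ((\<alpha> [^]\<^bsub>AutoGroup G\<^esub> k) x)"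
        using mult[OF \<alpha> pow x] A.nat_pow_Suc2[OF a] by simp
      also have "\<dots> = x \<otimes>\<^bsub>G\<^esub> z \<otimes>\<^bsub>G\<^esub> z [^]\<^bsub>G\<^esub> k"
        unfolding Suc using x z zk pVc by (simp add: auto_mult[OF \<alpha>] auto_fixes_pV[OF \<alpha>])
      also have "\<dots> = x \<otimes>\<^bsub>G\<^esub> z [^]\<^bsub>G\<^esub> Suc k"
        using x z(1) pVc by (metis m_assoc nat_pow_Suc2 nat_pow_closed)
      finally show ?case .
    qed
    have "(\<alpha> [^]\<^bsub>AutoGroup G\<^esub> p) x = \<one>\<^bsub>AutoGroup G\<^esub> x" if x: "x \<in> carrier G" for x
    proof -
      obtain z where "z \<in> pV" "\<alpha> x = x \<otimes>\<^bsub>G\<^esub> z"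
        using auto_translate[OF \<alpha> x] by blast
      then show ?thesis
        using iter[OF x] x by (simp add: one pV_pow)
    qed
    then show ?thesis
      using A.one_closed by (intro auto_eqI pow) (simp_all add: carrier)
  qed
  ultimately show ?thesis
    using prime_p by (simp add: elementary_abelian_def)
qed

text \<open>Evaluation at the generators is injective by \<open>auto_eqI\<close> and reaches every
  tuple of lifts by \<open>auto_extension\<close>; each of the \<open>n\<close> generators has
  \<open>p^n\<close> lifts.\<close>

lemma order_Auto: "order (AutoGroup G) = p ^ (n * n)"
proof -
  let ?C = "\<lambda>j. {x \<in> carrier G. \<forall>i<n. [crd x i = crd (e j) i] (mod int p)}"
  let ?F = "\<lambda>\<alpha>. \<lambda>j\<in>{..<n}. \<alpha> (e j)"
  have "bij_betw ?F (auto G) (\<Pi>\<^sub>E j\<in>{..<n}. ?C j)"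
    unfolding bij_betw_def
  proof
    show "inj_on ?F (auto G)"
    proof (rule inj_onI)
      fix \<alpha> \<alpha>' assume "\<alpha> \<in> auto G" "\<alpha>' \<in> auto G" and eq: "?F \<alpha> = ?F \<alpha>'"
      moreover have "\<alpha> (e j) = \<alpha>' (e j)" if "j < n" for j
        using fun_cong[OF eq, of j] that by simp
      ultimately show "\<alpha> = \<alpha>'"
        by (intro auto_eqI)
    qed
    show "?F ` auto G = (\<Pi>\<^sub>E j\<in>{..<n}. ?C j)"
    proof
      show "?F ` auto G \<subseteq> (\<Pi>\<^sub>E j\<in>{..<n}. ?C j)"
        using rigid auto_closed by (auto split: if_splits)
    next
      show "(\<Pi>\<^sub>E j\<in>{..<n}. ?C j) \<subseteq> ?F ` auto G"
      proof
        fix h assume h: "h \<in> (\<Pi>\<^sub>E j\<in>{..<n}. ?C j)"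
        then have "h j \<in> ?C j" if "j < n" for j
          using that by blast
        then obtain \<alpha> where \<alpha>: "\<alpha> \<in> auto G" "\<And>j. j < n \<Longrightarrow> \<alpha> (e j) = h j"
          using auto_extension[of h] by blast
        have "h = ?F \<alpha>"
          using \<alpha>(2) PiE_arb[OF h] by (intro ext) (simp add: restrict_def)
        then show "h \<in> ?F ` auto G"
          using \<alpha>(1) by blast
      qed
    qed
  qed
  then have "card (auto G) = (\<Prod>j<n. card (?C j))"
    by (simp add: bij_betw_same_card card_PiE)
  also have "\<dots> = p ^ (n * n)"
    by (simp add: card_congruent power_mult)
  finally show ?thesis
    by (simp add: order_def AutoGroup_def)
qed

end

section \<open>The bracket on \<open>V\<close> in terms of the group\<close>

text \<open>This expresses \<open>[x, y] = w\<close> in \<open>V\<close> as a relation in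
  \<open>G\<close>, with the \<open>p\<close>-th power carrying \<open>w\<close> into
  \<open>pV\<close>. The factor \<open>w^p\<close> brings no correction, its coordinates being
  divisible by \<open>p\<close>.\<close>

lemma commutator_relation:
  assumes x: "x \<in> carrier G" and y: "y \<in> carrier G" and w: "w \<in> carrier G"
  shows "x \<otimes>\<^bsub>G\<^esub> y = y \<otimes>\<^bsub>G\<^esub> x \<otimes>\<^bsub>G\<^esub> w [^]\<^bsub>G\<^esub> p \<longleftrightarrow>
    (\<forall>i<n. [\<beta> i (crd x) (crd y) - \<beta> i (crd y) (crd x) = crd w i] (mod int p))"
proof -
  have "[crd (x \<otimes>\<^bsub>G\<^esub> y) i = crd (y \<otimes>\<^bsub>G\<^esub> x \<otimes>\<^bsub>G\<^esub> w [^]\<^bsub>G\<^esub> p) i] (mod (int p)\<^sup>2) \<longleftrightarrow>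
    [\<beta> i (crd x) (crd y) - \<beta> i (crd y) (crd x) = crd w i] (mod int p)" if i: "i < n" for i
  proof -
    have "[\<beta> i (crd (y \<otimes>\<^bsub>G\<^esub> x)) (crd (w [^]\<^bsub>G\<^esub> p)) = 0] (mod int p)"
      using pow_in_pV[OF w] by (intro beta_zero) (simp add: pV_def cong_0_iff)
    from cong_p_mult[OF this]
    have "[crd (y \<otimes>\<^bsub>G\<^esub> x \<otimes>\<^bsub>G\<^esub> w [^]\<^bsub>G\<^esub> p) i =
        (crd y i + crd x i + int p * \<beta> i (crd y) (crd x)) + int p * crd w i + int p * 0] (mod (int p)\<^sup>2)"
      by (intro cong_trans[OF crd_mult[OF i]] cong_add crd_mult crd_pow_prime i)
    then have "[crd (x \<otimes>\<^bsub>G\<^esub> y) i = crd (y \<otimes>\<^bsub>G\<^esub> x \<otimes>\<^bsub>G\<^esub> w [^]\<^bsub>G\<^esub> p) i] (mod (int p)\<^sup>2) \<longleftrightarrow>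
      [crd x i + crd y i + int p * \<beta> i (crd x) (crd y)
       = crd x i + crd y i + int p * (\<beta> i (crd y) (crd x) + crd w i)] (mod (int p)\<^sup>2)"
      using crd_mult[OF i, of x y] by (simp add: cong_def algebra_simps)
    also have "\<dots> \<longleftrightarrow> [\<beta> i (crd x) (crd y) = \<beta> i (crd y) (crd x) + crd w i] (mod int p)"
      by (simp only: cong_add_lcancel cong_p_mult_iff)
    also have "\<dots> \<longleftrightarrow> [\<beta> i (crd x) (crd y) - \<beta> i (crd y) (crd x) = crd w i] (mod int p)"
      by (simp add: cong_iff_dvd_diff algebra_simps)
    finally show ?thesis .
  qed
  then show ?thesis
    using x y w by (auto intro!: crd_eqI)
qed

text \<open>Automorphisms preserve relations of \<open>G\<close>, hence the bracket on
  \<open>V\<close>.\<close>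

lemma auto_commutator_relation:
  assumes \<alpha>: "\<alpha> \<in> auto G" and x: "x \<in> carrier G" and y: "y \<in> carrier G" and w: "w \<in> carrier G"
    and rel: "\<And>i. i < n \<Longrightarrow> [\<beta> i (crd x) (crd y) - \<beta> i (crd y) (crd x) = crd w i] (mod int p)"
    and i: "i < n"
  shows "[\<beta> i (crd (\<alpha> x)) (crd (\<alpha> y)) - \<beta> i (crd (\<alpha> y)) (crd (\<alpha> x)) = crd (\<alpha> w) i] (mod int p)"
proof -
  have "x \<otimes>\<^bsub>G\<^esub> y = y \<otimes>\<^bsub>G\<^esub> x \<otimes>\<^bsub>G\<^esub> w [^]\<^bsub>G\<^esub> p"
    using commutator_relation[OF x y w] rel by blast
  then have "\<alpha> (x \<otimes>\<^bsub>G\<^esub> y) = \<alpha> (y \<otimes>\<^bsub>G\<^esub> x \<otimes>\<^bsub>G\<^esub> w [^]\<^bsub>G\<^esub> p)" by simp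
  then have "\<alpha> x \<otimes>\<^bsub>G\<^esub> \<alpha> y = \<alpha> y \<otimes>\<^bsub>G\<^esub> \<alpha> x \<otimes>\<^bsub>G\<^esub> \<alpha> w [^]\<^bsub>G\<^esub> p"
    using x y w by (simp add: auto_mult[OF \<alpha>] auto_pow[OF \<alpha>])
  then show ?thesis
    using commutator_relation[of "\<alpha> x" "\<alpha> y" "\<alpha> w"] auto_closed[OF \<alpha>] x y w i by blast
qed

end

section \<open>A rigid anticommutative algebra of dimension four\<close>

text \<open>Writing \<open>a, b, c, t\<close> for the basis \<open>0, 1, 2, 3\<close>, the nonzero brackets are
  \<open>[c,b] = a\<close>, \<open>[c,a] = a + b\<close>, \<open>[t,a] = c\<close> and \<open>[t,b] = b\<close>.\<close>

definition structure_constant :: "nat \<Rightarrow> nat \<Rightarrow> nat \<Rightarrow> int" where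
  "structure_constant i j k =
    (if (i, j, k) \<in> {(0, 2, 1), (0, 2, 0), (1, 2, 0), (2, 3, 0), (1, 3, 1)} then 1 else 0)"

locale rigid_group = twisted_group p 4 structure_constant for p
begin

section \<open>Center and commutator subgroup of the concrete group\<close>

lemma less_4_iff: "i < (4::nat) \<longleftrightarrow> i = 0 \<or> i = 1 \<or> i = 2 \<or> i = 3"
  by auto

lemma beta_eq:
  "\<beta> 0 x y = x 2 * (y 0 + y 1)"
  "\<beta> 1 x y = x 2 * y 0 + x 3 * y 1"
  "\<beta> (Suc 0) x y = x 2 * y 0 + x 3 * y 1"
  "\<beta> 2 x y = x 3 * y 0"
  "\<beta> 3 x y = 0"
  unfolding \<beta>_def by (simp_all add: structure_constant_def eval_nat_numeral algebra_simps)

lemma center_eq_pV: "center G = pV"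
proof
  show "pV \<subseteq> center G"
    using pV_central by (auto simp: center_def pV_def)
  show "center G \<subseteq> pV"
  proof
    fix x assume "x \<in> center G"
    then have x: "x \<in> carrier G" and comm: "\<And>y. y \<in> carrier G \<Longrightarrow> x \<otimes>\<^bsub>G\<^esub> y = y \<otimes>\<^bsub>G\<^esub> x"
      by (auto simp: center_def)
    have "x \<otimes>\<^bsub>G\<^esub> e j = e j \<otimes>\<^bsub>G\<^esub> x \<otimes>\<^bsub>G\<^esub> \<one>\<^bsub>G\<^esub> [^]\<^bsub>G\<^esub> p" for j
      using comm[of "e j"] x by simp
    then have "[\<beta> i (crd x) (crd (e j)) - \<beta> i (crd (e j)) (crd x) = crd \<one>\<^bsub>G\<^esub> i] (mod int p)" if "i < 4" for i j
      using commutator_relation[OF x e_closed one_closed] that by blast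
    moreover have "[\<beta> i (crd x) (crd (e j)) - \<beta> i (crd (e j)) (crd x)
        = \<beta> i (crd x) (\<lambda>k. if k = j then 1 else 0) - \<beta> i (\<lambda>k. if k = j then 1 else 0) (crd x)] (mod int p)"
      if "i < 4" for i j
      by (intro cong_diff beta_cong cong_refl crd_e_p)
    ultimately have rel: "[\<beta> i (crd x) (\<lambda>k. if k = j then 1 else 0) - \<beta> i (\<lambda>k. if k = j then 1 else 0) (crd x) = 0] (mod int p)"
      if "i < 4" for i j
      using crd_one_p that unfolding cong_def by metis
    \<comment> \<open>Up to sign, the bracket with \<open>e 0\<close> shows coordinates 2 and 3 of
      \<open>x\<close>, and the bracket with \<open>e 3\<close> shows coordinates 1 and 0: the
      annihilator is zero.\<close>
    have "[crd x 2 = 0] (mod int p)" "[crd x 3 = 0] (mod int p)"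
      "[crd x 1 = 0] (mod int p)" "[crd x 0 = 0] (mod int p)"
      using rel[of 0 0] rel[of 2 0] rel[of 1 3] rel[of 2 3] by (simp_all add: beta_eq cong_0_iff)
    then show "x \<in> pV"
      using x by (auto simp: pV_def less_4_iff)
  qed
qed

text \<open>No bracket has a component along \<open>t\<close>, so coordinate 3 is additive even
  modulo \<open>p^2\<close> and kills commutators, while the \<open>p\<close>-th power of
  \<open>e 3\<close> has the nonzero coordinate \<open>p\<close> there.\<close>

lemma derived_psubset: "derived G (carrier G) \<subset> pV"
proof -
  have "[crd (x \<otimes>\<^bsub>G\<^esub> y) 3 = crd x 3 + crd y 3] (mod (int p)\<^sup>2)" for x y
    using crd_mult[of 3 x y] by (simp add: beta_eq)
  then have "[crd x 3 = 0] (mod (int p)\<^sup>2)" if "x \<in> derived G (carrier G)" for x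
    using derived_crd[of 3 "(int p)\<^sup>2", OF _ _ _ that] by simp
  moreover have "\<not> [crd (e 3 [^]\<^bsub>G\<^esub> p) 3 = 0] (mod (int p)\<^sup>2)"
  proof -
    have "[crd (e 3 [^]\<^bsub>G\<^esub> p) 3 = int p * 1] (mod (int p)\<^sup>2)"
      using cong_trans[OF crd_pow_prime cong_p_mult[OF crd_e_p[of 3 3]]] by simp
    moreover have "\<not> [int p * 1 = int p * 0] (mod (int p)\<^sup>2)"
      unfolding cong_p_mult_iff using prime_gt_1_nat[OF prime_p] by (simp add: cong_def)
    ultimately show ?thesis
      by (simp add: cong_def)
  qed
  ultimately have "e 3 [^]\<^bsub>G\<^esub> p \<notin> derived G (carrier G)"
    by blast
  then show ?thesis
    using derived_subset_pV pow_in_pV[of "e 3"] by auto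
qed

section \<open>Rigidity of the algebra\<close>

text \<open>The vectors stand for the images of the basis under a map preserving the bracket; the
  nonvanishing of \<open>a\<close> excludes degenerate solutions such as zero. The relations are
  compared coordinate by coordinate, beginning with coordinates 3 and 2, where \<beta> is
  simplest.\<close>

lemma bracket_rigid:
  fixes a b c t :: "nat \<Rightarrow> int"
  assumes cb: "\<And>i. i < 4 \<Longrightarrow> [\<beta> i c b - \<beta> i b c = a i] (mod int p)"
    and ca: "\<And>i. i < 4 \<Longrightarrow> [\<beta> i c a - \<beta> i a c = a i + b i] (mod int p)"
    and ta: "\<And>i. i < 4 \<Longrightarrow> [\<beta> i t a - \<beta> i a t = c i] (mod int p)"
    and tb: "\<And>i. i < 4 \<Longrightarrow> [\<beta> i t b - \<beta> i b t = b i] (mod int p)"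
    and tc: "\<And>i. i < 4 \<Longrightarrow> [\<beta> i t c - \<beta> i c t = 0] (mod int p)"
    and nz: "i < 4" "\<not> [a i = 0] (mod int p)"
    and i: "i' < 4"
  shows "[a i' = (if i' = 0 then 1 else 0)] (mod int p)"
    "[b i' = (if i' = 1 then 1 else 0)] (mod int p)"
    "[c i' = (if i' = 2 then 1 else 0)] (mod int p)"
    "[t i' = (if i' = 3 then 1 else 0)] (mod int p)"
proof -
  have cancel: "[v = w] (mod int p)" if "[u * v = u * w] (mod int p)" "\<not> [u = 0] (mod int p)" for u v w
  proof -
    have "int p dvd u * (v - w)"
      using that(1) by (simp add: cong_iff_dvd_diff algebra_simps)
    then show ?thesis
      using that(2) prime_p by (simp add: prime_dvd_mult_iff cong_0_iff) (simp add: cong_iff_dvd_diff)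
  qed
  \<comment> \<open>The vectors \<open>a\<close>, \<open>b\<close> and \<open>c\<close> are
    brackets, and brackets have no coordinate 3.\<close>
  have a3: "[a 3 = 0] (mod int p)"
    using cb[of 3] by (simp add: beta_eq cong_sym_eq)
  have b3: "[b 3 = 0] (mod int p)"
    using tb[of 3] by (simp add: beta_eq cong_sym_eq)
  have c3: "[c 3 = 0] (mod int p)"
    using ta[of 3] by (simp add: beta_eq cong_sym_eq)
  have "[c 3 * b 0 - b 3 * c 0 = 0 * b 0 - 0 * c 0] (mod int p)"
    by (intro cong_diff cong_mult cong_refl c3 b3)
  with cb[of 2] have a2: "[a 2 = 0] (mod int p)"
    by (simp add: beta_eq cong_def)
  have "[c 3 * a 0 - a 3 * c 0 = 0 * a 0 - 0 * c 0] (mod int p)"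
    by (intro cong_diff cong_mult cong_refl c3 a3)
  with ca[of 2] have "[a 2 + b 2 = 0] (mod int p)"
    by (simp add: beta_eq cong_def)
  from cong_diff[OF this a2] have b2: "[b 2 = 0] (mod int p)"
    by simp
  have "[t 3 * b 0 - b 3 * t 0 = t 3 * b 0 - 0 * t 0] (mod int p)"
    by (intro cong_diff cong_mult cong_refl b3)
  with tb[of 2] b2 have tb0: "[t 3 * b 0 = 0] (mod int p)"
    by (simp add: beta_eq cong_def)
  have "[t 3 * a 0 - a 3 * t 0 = t 3 * a 0 - 0 * t 0] (mod int p)"
    by (intro cong_diff cong_mult cong_refl a3)
  with ta[of 2] have c2: "[c 2 = t 3 * a 0] (mod int p)"
    by (simp add: beta_eq cong_def)
  have "[c 2 * b 0 + c 3 * b 1 - (b 2 * c 0 + b 3 * c 1) = t 3 * a 0 * b 0 + 0 * b 1 - (0 * c 0 + 0 * c 1)] (mod int p)"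
    by (intro cong_diff cong_add cong_mult cong_refl c2 c3 b2 b3)
  with cb[of 1] have "[a 1 = t 3 * b 0 * a 0] (mod int p)"
    by (simp add: beta_eq cong_def ac_simps)
  from cong_trans[OF this cong_mult[OF tb0 cong_refl]] have a1: "[a 1 = 0] (mod int p)"
    by simp
  \<comment> \<open>Only coordinate 0 of \<open>a\<close> remains. Its nonvanishing passes to
    \<open>c 2\<close> and \<open>t 3\<close>, which permits the cancellations below.\<close>
  have a0: "\<not> [a 0 = 0] (mod int p)"
    using nz a1 a2 a3 by (auto simp: less_4_iff)
  have "[c 2 * (b 0 + b 1) - b 2 * (c 0 + c 1) = c 2 * (b 0 + b 1) - 0 * (c 0 + c 1)] (mod int p)"
    by (intro cong_diff cong_mult cong_refl b2)
  with cb[of 0] have a0': "[a 0 = c 2 * (b 0 + b 1)] (mod int p)"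
    by (simp add: beta_eq cong_def)
  have c2nz: "\<not> [c 2 = 0] (mod int p)"
    using cong_trans[OF a0' cong_mult[of "c 2" 0, OF _ cong_refl]] a0 by auto
  then have t3nz: "\<not> [t 3 = 0] (mod int p)"
    using cong_trans[OF c2 cong_mult[of "t 3" 0, OF _ cong_refl]] by auto
  have b0: "[b 0 = 0] (mod int p)"
    using cancel[of "t 3" "b 0" 0] tb0 t3nz by simp
  \<comment> \<open>The relations \<open>[c,a] = a + b\<close> and \<open>[t,b] = b\<close> rule out
    rescaling: they force \<open>c 2 = 1\<close>, \<open>b 1 = a 0\<close> and
    \<open>t 3 = 1\<close>, and then \<open>c 2 = t 3 * a 0\<close> gives
    \<open>a 0 = 1\<close>.\<close>
  have "[c 2 * (a 0 + a 1) - a 2 * (c 0 + c 1) = c 2 * (a 0 + 0) - 0 * (c 0 + c 1)] (mod int p)"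
    by (intro cong_diff cong_mult cong_add cong_refl a1 a2)
  moreover have "[a 0 + b 0 = a 0 + 0] (mod int p)"
    by (intro cong_add cong_refl b0)
  ultimately have ca0: "[a 0 * c 2 = a 0 * 1] (mod int p)"
    using ca[of 0] by (simp add: beta_eq cong_def ac_simps)
  then have c2': "[c 2 = 1] (mod int p)"
    using cancel a0 by blast
  have "[c 2 * a 0 + c 3 * a 1 - (a 2 * c 0 + a 3 * c 1) = c 2 * a 0 + 0 * a 1 - (0 * c 0 + 0 * c 1)] (mod int p)"
    by (intro cong_diff cong_add cong_mult cong_refl c3 a2 a3)
  moreover have "[a 1 + b 1 = 0 + b 1] (mod int p)"
    by (intro cong_add cong_refl a1)
  ultimately have ab: "[a 0 = b 1] (mod int p)"
    using ca[of 1] ca0 by (simp add: beta_eq cong_def ac_simps)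
  have "[t 2 * b 0 + t 3 * b 1 - (b 2 * t 0 + b 3 * t 1) = t 2 * 0 + t 3 * b 1 - (0 * t 0 + 0 * t 1)] (mod int p)"
    by (intro cong_diff cong_add cong_mult cong_refl b0 b2 b3)
  with tb[of 1] have "[b 1 * t 3 = b 1 * 1] (mod int p)"
    by (simp add: beta_eq cong_def ac_simps)
  moreover have "\<not> [b 1 = 0] (mod int p)"
    using a0 ab by (simp add: cong_def)
  ultimately have t3: "[t 3 = 1] (mod int p)"
    using cancel by blast
  have a0'': "[a 0 = 1] (mod int p)"
    using cong_trans[OF c2 cong_mult[OF t3 cong_refl]] c2' by (simp add: cong_def)
  have b1: "[b 1 = 1] (mod int p)"
    using ab a0'' by (simp add: cong_def)
  \<comment> \<open>Next \<open>[t,b] = b\<close> removes \<open>t 2\<close>, then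
    \<open>[t,a] = c\<close> removes \<open>c 0\<close> and \<open>c 1\<close>, and finally
    \<open>[t,c] = 0\<close> removes \<open>t 0\<close> and \<open>t 1\<close>.\<close>
  have "[t 2 * (b 0 + b 1) - b 2 * (t 0 + t 1) = t 2 * (0 + 1) - 0 * (t 0 + t 1)] (mod int p)"
    by (intro cong_diff cong_mult cong_add cong_refl b0 b1 b2)
  with tb[of 0] b0 have t2: "[t 2 = 0] (mod int p)"
    by (simp add: beta_eq cong_def)
  have "[t 2 * (a 0 + a 1) - a 2 * (t 0 + t 1) = 0 * (a 0 + a 1) - 0 * (t 0 + t 1)] (mod int p)"
    by (intro cong_diff cong_mult cong_refl t2 a2)
  with ta[of 0] have c0: "[c 0 = 0] (mod int p)"
    by (simp add: beta_eq cong_def)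
  have "[t 2 * a 0 + t 3 * a 1 - (a 2 * t 0 + a 3 * t 1) = 0 * a 0 + t 3 * 0 - (0 * t 0 + 0 * t 1)] (mod int p)"
    by (intro cong_diff cong_add cong_mult cong_refl t2 a1 a2 a3)
  with ta[of 1] have c1: "[c 1 = 0] (mod int p)"
    by (simp add: beta_eq cong_def)
  have "[t 2 * c 0 + t 3 * c 1 - (c 2 * t 0 + c 3 * t 1) = 0 * c 0 + t 3 * 0 - (1 * t 0 + 0 * t 1)] (mod int p)"
    by (intro cong_diff cong_add cong_mult cong_refl t2 c1 c2' c3)
  with tc[of 1] have "[- t 0 = 0] (mod int p)"
    by (simp add: beta_eq cong_def)
  then have t0: "[t 0 = 0] (mod int p)"
    by (simp add: cong_0_iff)
  have "[t 2 * (c 0 + c 1) - c 2 * (t 0 + t 1) = 0 * (c 0 + c 1) - 1 * (0 + t 1)] (mod int p)"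
    by (intro cong_diff cong_mult cong_add cong_refl t2 c2' t0)
  with tc[of 0] have "[- t 1 = 0] (mod int p)"
    by (simp add: beta_eq cong_def)
  then have t1: "[t 1 = 0] (mod int p)"
    by (simp add: cong_0_iff)
  note i' = i[unfolded less_4_iff]
  show "[a i' = (if i' = 0 then 1 else 0)] (mod int p)"
    using i' by (elim disjE; use a0'' a1 a2 a3 in simp)
  show "[b i' = (if i' = 1 then 1 else 0)] (mod int p)"
    using i' by (elim disjE; use b0 b1 b2 b3 in simp)
  show "[c i' = (if i' = 2 then 1 else 0)] (mod int p)"
    using i' by (elim disjE; use c0 c1 c2' c3 in simp)
  show "[t i' = (if i' = 3 then 1 else 0)] (mod int p)"
    using i' by (elim disjE; use t0 t1 t2 t3 in simp)
qed

text \<open>The images of the generators satisfy the bracket relations of the basis modulo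
  \<open>p\<close>, so \<open>bracket_rigid\<close> applies once the image of \<open>e 0\<close> is
  known to be nonzero in \<open>V\<close>.\<close>

lemma auto_trivial_mod_p:
  assumes \<alpha>: "\<alpha> \<in> auto G" and i: "i < 4" and j: "j < 4"
  shows "[crd (\<alpha> (e j)) i = crd (e j) i] (mod int p)"
proof -
  let ?u = "\<lambda>j k. if k = j then 1 else (0 :: int)"
  have rel: "[\<beta> i (crd (\<alpha> (e j))) (crd (\<alpha> (e k))) - \<beta> i (crd (\<alpha> (e k))) (crd (\<alpha> (e j))) = crd (\<alpha> w) i] (mod int p)"
    if i: "i < 4" and w: "w \<in> carrier G"
      and jk: "\<And>i. i < 4 \<Longrightarrow> [\<beta> i (?u j) (?u k) - \<beta> i (?u k) (?u j) = crd w i] (mod int p)" for i j k w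
  proof (rule auto_commutator_relation[OF \<alpha> _ _ w _ i])
    fix i :: nat assume "i < 4"
    have "[\<beta> i (crd (e j)) (crd (e k)) - \<beta> i (crd (e k)) (crd (e j))
        = \<beta> i (?u j) (?u k) - \<beta> i (?u k) (?u j)] (mod int p)"
      by (intro cong_diff beta_cong crd_e_p)
    then show "[\<beta> i (crd (e j)) (crd (e k)) - \<beta> i (crd (e k)) (crd (e j)) = crd w i] (mod int p)"
      using jk[OF \<open>i < 4\<close>] by (rule cong_trans)
  qed simp_all
  have ee: "[crd (e j) i = ?u j i] (mod int p)" "[?u j i = crd (e j) i] (mod int p)" if "i < 4" for i j
    using crd_e_p[OF that, of j] by (simp_all add: cong_sym_eq)
  \<comment> \<open>The relation \<open>[c,a] = a + b\<close> needs a group element on its right;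
    modulo \<open>p\<close>, the product of \<open>e 0\<close> and \<open>e 1\<close> has the
    coordinates of \<open>a + b\<close>.\<close>
  have ab: "[?u 0 i + ?u 1 i = crd (e 0 \<otimes>\<^bsub>G\<^esub> e 1) i] (mod int p)" if "i < 4" for i
    by (rule cong_sym) (intro cong_trans[OF crd_mult_p] cong_add ee that)
  have cb: "[\<beta> i (crd (\<alpha> (e 2))) (crd (\<alpha> (e 1))) - \<beta> i (crd (\<alpha> (e 1))) (crd (\<alpha> (e 2))) = crd (\<alpha> (e 0)) i] (mod int p)"
    if "i < 4" for i
  proof (rule rel[OF that e_closed])
    fix i :: nat assume "i < 4"
    then show "[\<beta> i (?u 2) (?u 1) - \<beta> i (?u 1) (?u 2) = crd (e 0) i] (mod int p)"
      using ee(2)[of i 0] by (auto simp: less_4_iff beta_eq)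
  qed
  have ta: "[\<beta> i (crd (\<alpha> (e 3))) (crd (\<alpha> (e 0))) - \<beta> i (crd (\<alpha> (e 0))) (crd (\<alpha> (e 3))) = crd (\<alpha> (e 2)) i] (mod int p)"
    if "i < 4" for i
  proof (rule rel[OF that e_closed])
    fix i :: nat assume "i < 4"
    then show "[\<beta> i (?u 3) (?u 0) - \<beta> i (?u 0) (?u 3) = crd (e 2) i] (mod int p)"
      using ee(2)[of i 2] by (auto simp: less_4_iff beta_eq)
  qed
  have tb: "[\<beta> i (crd (\<alpha> (e 3))) (crd (\<alpha> (e 1))) - \<beta> i (crd (\<alpha> (e 1))) (crd (\<alpha> (e 3))) = crd (\<alpha> (e 1)) i] (mod int p)"
    if "i < 4" for i
  proof (rule rel[OF that e_closed])
    fix i :: nat assume "i < 4"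
    then show "[\<beta> i (?u 3) (?u 1) - \<beta> i (?u 1) (?u 3) = crd (e 1) i] (mod int p)"
      using ee(2)[of i 1] by (auto simp: less_4_iff beta_eq)
  qed
  have ca: "[\<beta> i (crd (\<alpha> (e 2))) (crd (\<alpha> (e 0))) - \<beta> i (crd (\<alpha> (e 0))) (crd (\<alpha> (e 2)))
      = crd (\<alpha> (e 0)) i + crd (\<alpha> (e 1)) i] (mod int p)" if "i < 4" for i
  proof -
    have "[\<beta> i (crd (\<alpha> (e 2))) (crd (\<alpha> (e 0))) - \<beta> i (crd (\<alpha> (e 0))) (crd (\<alpha> (e 2)))
      = crd (\<alpha> (e 0 \<otimes>\<^bsub>G\<^esub> e 1)) i] (mod int p)"
    proof (rule rel[OF that])
      fix i :: nat assume "i < 4"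
      then show "[\<beta> i (?u 2) (?u 0) - \<beta> i (?u 0) (?u 2) = crd (e 0 \<otimes>\<^bsub>G\<^esub> e 1) i] (mod int p)"
        using ab[of i] by (auto simp: less_4_iff beta_eq)
    qed simp
    also have "\<alpha> (e 0 \<otimes>\<^bsub>G\<^esub> e 1) = \<alpha> (e 0) \<otimes>\<^bsub>G\<^esub> \<alpha> (e 1)"
      by (simp add: auto_mult[OF \<alpha>])
    also have "[crd (\<alpha> (e 0) \<otimes>\<^bsub>G\<^esub> \<alpha> (e 1)) i = crd (\<alpha> (e 0)) i + crd (\<alpha> (e 1)) i] (mod int p)"
      by (rule crd_mult_p[OF that])
    finally show ?thesis .
  qed
  \<comment> \<open>Here \<open>[t,c] = 0\<close> is the commutator relation whose \<open>w\<close>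
    is the identity of \<open>G\<close>.\<close>
  have tc: "[\<beta> i (crd (\<alpha> (e 3))) (crd (\<alpha> (e 2))) - \<beta> i (crd (\<alpha> (e 2))) (crd (\<alpha> (e 3))) = 0] (mod int p)"
    if "i < 4" for i
  proof -
    have "[\<beta> i (crd (\<alpha> (e 3))) (crd (\<alpha> (e 2))) - \<beta> i (crd (\<alpha> (e 2))) (crd (\<alpha> (e 3))) = crd (\<alpha> \<one>\<^bsub>G\<^esub>) i] (mod int p)"
    proof (rule rel[OF that one_closed])
      fix i :: nat assume "i < 4"
      then show "[\<beta> i (?u 3) (?u 2) - \<beta> i (?u 2) (?u 3) = crd \<one>\<^bsub>G\<^esub> i] (mod int p)"
        using cong_sym[OF crd_one_p, of i] by (auto simp: less_4_iff beta_eq)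
    qed
    then show ?thesis
      using crd_one_p[OF that] group_hom.hom_one[OF auto_group_hom[OF \<alpha>]] by (simp add: cong_def)
  qed
  \<comment> \<open>Otherwise the image of \<open>e 0\<close>, and by injectivity \<open>e 0\<close>
    itself, would have trivial \<open>p\<close>-th power, but coordinate 0 of that power is
    \<open>p\<close>.\<close>
  have "\<alpha> (e 0) \<notin> pV"
  proof
    assume "\<alpha> (e 0) \<in> pV"
    then have "\<alpha> (e 0 [^]\<^bsub>G\<^esub> p) = \<alpha> \<one>\<^bsub>G\<^esub>"
      using group_hom.hom_one[OF auto_group_hom[OF \<alpha>]] by (simp add: auto_pow[OF \<alpha>] pV_pow)
    moreover have "inj_on \<alpha> (carrier G)"
      using \<alpha> by (simp add: auto_def Bij_def bij_betw_def)
    ultimately have "e 0 [^]\<^bsub>G\<^esub> p = \<one>\<^bsub>G\<^esub>"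
      by (simp add: inj_on_eq_iff)
    then have "[int p * crd (e 0) 0 = int p * 0] (mod (int p)\<^sup>2)"
      using crd_pow_prime[of 0 "e 0"] crd_one[of 0] by (simp add: cong_def)
    then have "[1 = 0] (mod int p)"
      using ee(1)[of 0 0] unfolding cong_p_mult_iff by (simp add: cong_def)
    then show False
      using prime_gt_1_nat[OF prime_p] by (simp add: cong_def)
  qed
  then obtain k where k: "k < 4" "\<not> [crd (\<alpha> (e 0)) k = 0] (mod int p)"
    using auto_closed[OF \<alpha> e_closed] by (auto simp: pV_def)
  note rigid = bracket_rigid[OF cb ca ta tb tc k i]
  have "[crd (\<alpha> (e j)) i = ?u j i] (mod int p)"
    using j rigid by (auto simp: less_4_iff)
  then show ?thesis
    using ee(2)[OF i, of j] by (rule cong_trans)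
qed

end

theorem theoremC:
  fixes p :: nat
  assumes "Factorial_Ring.prime p" and "odd p"
  shows "\<exists>G :: nat monoid.
           group G \<and> order G = p ^ 8 \<and>
           elementary_abelian p (AutoGroup G) \<and> order (AutoGroup G) = p ^ 16 \<and>
           derived G (carrier G) \<subset> frattini G \<and>
           center G = frattini G \<and>
           elementary_abelian p (G\<lparr>carrier := frattini G\<rparr>)"
proof -
  interpret rigid_group p
    by unfold_locales (use assms in auto)
  \<comment> \<open>With \<open>n = 4\<close>, the orders \<open>p^(2 n)\<close> of \<open>G\<close>
    and \<open>p^(n n)\<close> of its automorphism group are \<open>p^8\<close> and
    \<open>p^16\<close>.\<close>
  have "elementary_abelian p (AutoGroup G)"
    by (rule elementary_abelian_Auto) (rule auto_trivial_mod_p)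
  moreover have "order (AutoGroup G) = p ^ (4 * 4)"
    by (rule order_Auto) (rule auto_trivial_mod_p)
  ultimately show ?thesis
    using is_group card_G derived_psubset center_eq_pV elementary_abelian_pV
    by (intro exI[of _ G]) (simp add: frattini_eq_pV order_def)
qed

end
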